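(* Let $\mathcal{H}$ be a separable infinite-dimensional complex Hilbert space, and suppose that $T \in B(\mathcal{H})$ is a selfadjoint operator with $W(T) \subseteq W_{\mathrm{e}}(T)$ and with at least three points in the essential spectrum $\sigma_{\mathrm{ess}}(T)$. Then a sequence $(d_k)_{k=1}^{\infty}$ lies in $\mathcal{D}(T)$ if and only if all of the following hold: (1) $d_k \in W(T)$ for all $k$; (2) $$\sum_{k=1}^{\infty} \operatorname{dist}(d_k, \mathbb{R} \setminus W_{\mathrm{e}}(T)) = \infty;$$ (3) the number of occurrences of each of $\min \sigma_{\mathrm{ess}}(T)$ and $\max \sigma_{\mathrm{ess}}(T)$ in the sequence $(d_k)_{k=1}^{\infty}$ is less than or equal to the dimension of the corresponding eigenspace of $T$.
   Context: $B(\mathcal{H})$ denotes the bounded linear operators on $\mathcal{H}$. A diagonal of $T \in B(\mathcal{H})$ is a sequence $(\langle Te_n, e_n\rangle)_{n=1}^{\infty}$ where $\{e_n\}_{n=1}^{\infty}$ is an orthonormal basis of $\mathcal{H}$ (the basis is not fixed), and $\mathcal{D}(T)$ is the set of all diagonals of $T$, as the orthonormal basis varies. $W(T) = \{\langle Tx,x\rangle : \|x\| = 1\}$ is the numerical range of $T$. $W_{\mathrm{e}}(T)$ is the essential numerical range of $T$: $\lambda \in W_{\mathrm{e}}(T)$ if and only if some diagonal of $T$ contains a subsequence converging to $\lambda$ (equivalently, there is an orthonormal sequence $(x_n)$ with $\langle Tx_n,x_n\rangle \to \lambda$). The essential spectrum $\sigma_{\mathrm{ess}}(T)$ is the spectrum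 of the image of $T$ in the Calkin algebra $B(\mathcal{H})/\mathcal{K}(\mathcal{H})$, where $\mathcal{K}(\mathcal{H})$ is the ideal of compact operators. For $c \in \mathbb{R}$, the corresponding eigenspace of $T$ is $\ker(T - cI)$, of dimension $0$ if $c$ is not an eigenvalue; numbers of occurrences and dimensions lie in $\{0,1,2,\ldots\} \cup \{\infty\}$. $\operatorname{dist}(x, F) = \inf_{y \in F} |x-y|$. *)

theory Defs
  imports "HOL-Analysis.Analysis" "HOL-Algebra.QuotRing"
begin

section \<open>Complex Hilbert spaces\<close>

text \<open>
  The inner product is linear in the first argument. The real inner product of the
  superclass is its real part, so norm, metric and topology are the ones induced by
  \<open>cinner\<close>; completeness comes from \<^class>\<open>complete_space\<close>.
\<close>

class complex_hilbert = real_inner + complete_space +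
  fixes scaleC :: "complex \<Rightarrow> 'a \<Rightarrow> 'a"  (infixr \<open>*\<^sub>C\<close> 75)
    and cinner :: "'a \<Rightarrow> 'a \<Rightarrow> complex"
  assumes scaleC_add_right: "a *\<^sub>C (x + y) = a *\<^sub>C x + a *\<^sub>C y"
    and scaleC_add_left: "(a + b) *\<^sub>C x = a *\<^sub>C x + b *\<^sub>C x"
    and scaleC_scaleC: "a *\<^sub>C (b *\<^sub>C x) = (a * b) *\<^sub>C x"
    and scaleC_of_real: "complex_of_real r *\<^sub>C x = scaleR r x"
    and cinner_commute: "cinner x y = cnj (cinner y x)"
    and cinner_add_left: "cinner (x + y) z = cinner x z + cinner y z"
    and cinner_scaleC_left: "cinner (a *\<^sub>C x) y = a * cinner x y"
    and Re_cinner: "Re (cinner x y) = inner x y"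

instantiation complex :: complex_hilbert
begin

definition scaleC_complex :: "complex \<Rightarrow> complex \<Rightarrow> complex"
  where "scaleC_complex a x = a * x"

definition cinner_complex :: "complex \<Rightarrow> complex \<Rightarrow> complex"
  where "cinner_complex x y = x * cnj y"

instance
  by standard
    (simp_all add: scaleC_complex_def cinner_complex_def algebra_simps scaleR_conv_of_real
      inner_complex_def)

end

global_interpretation complex_vector: vector_space
  "scaleC :: complex \<Rightarrow> 'a \<Rightarrow> 'a::complex_hilbert"
  defines cspan = complex_vector.span
    and cdim = complex_vector.dim
proof
  show "1 *\<^sub>C x = x" for x :: 'a
    using scaleC_of_real[of 1 x] by simp
qed (simp_all add: scaleC_add_right scaleC_add_left scaleC_scaleC)

lemma cinner_self: "cinner x x = complex_of_real ((norm x)\<^sup>2)"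
proof (rule complex_eqI)
  show "Re (cinner x x) = Re (complex_of_real ((norm x)\<^sup>2))"
    by (simp add: Re_cinner power2_norm_eq_inner)
  have "Im (cinner x x) = - Im (cinner x x)"
    by (subst cinner_commute) simp
  then show "Im (cinner x x) = Im (complex_of_real ((norm x)\<^sup>2))"
    by simp
qed

text \<open>Cardinalities and dimensions with values in \<open>{0, 1, 2, \<dots>} \<union> {\<infinity>}\<close>.\<close>

definition ecard :: "'b set \<Rightarrow> enat"
  where "ecard S = (if finite S then enat (card S) else \<infinity>)"

definition ecdim :: "'a::complex_hilbert set \<Rightarrow> enat"
  where "ecdim V = (if \<exists>B. finite B \<and> V \<subseteq> cspan B then enat (cdim V) else \<infinity>)"

definition orthonormal_basis :: "(nat \<Rightarrow> 'a::complex_hilbert) \<Rightarrow> bool"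
  where "orthonormal_basis e \<longleftrightarrow>
    (\<forall>m n. cinner (e m) (e n) = (if m = n then 1 else 0)) \<and>
    closure (cspan (range e)) = UNIV"


section \<open>Operators, diagonals and numerical ranges\<close>

definition bounded_op :: "('a::complex_hilbert \<Rightarrow> 'a) \<Rightarrow> bool"
  where "bounded_op T \<longleftrightarrow> bounded_linear T \<and> (\<forall>a x. T (a *\<^sub>C x) = a *\<^sub>C T x)"

definition selfadjoint :: "('a::complex_hilbert \<Rightarrow> 'a) \<Rightarrow> bool"
  where "selfadjoint T \<longleftrightarrow> (\<forall>x y. cinner (T x) y = cinner x (T y))"

definition diagonals :: "('a::complex_hilbert \<Rightarrow> 'a) \<Rightarrow> (nat \<Rightarrow> complex) set"
  where "diagonals T = {(\<lambda>n. cinner (T (e n)) (e n)) | e. orthonormal_basis e}"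

definition numerical_range :: "('a::complex_hilbert \<Rightarrow> 'a) \<Rightarrow> complex set"
  where "numerical_range T = {cinner (T x) x | x. norm x = 1}"

definition ess_numerical_range :: "('a::complex_hilbert \<Rightarrow> 'a) \<Rightarrow> complex set"
  where "ess_numerical_range T =
    {l. \<exists>d \<in> diagonals T. \<exists>r. strict_mono r \<and> (d \<circ> r) \<longlonglongrightarrow> l}"

definition eigenspace :: "('a::complex_hilbert \<Rightarrow> 'a) \<Rightarrow> complex \<Rightarrow> 'a set"
  where "eigenspace T c = {x. T x - c *\<^sub>C x = 0}"


section \<open>The Calkin algebra and the essential spectrum\<close>

definition op_ring :: "('a::complex_hilbert \<Rightarrow> 'a) ring"
  where "op_ring =
    \<lparr>carrier = {T. bounded_op T}, mult = (\<lambda>S T. S \<circ> T), one = id,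
     zero = (\<lambda>x. 0), add = (\<lambda>S T x. S x + T x)\<rparr>"

definition compact_ops :: "('a::complex_hilbert \<Rightarrow> 'a) set"
  where "compact_ops = {K. bounded_op K \<and> compact (closure (K ` cball 0 1))}"

definition calkin :: "('a::complex_hilbert \<Rightarrow> 'a) set ring"
  where "calkin = op_ring Quot compact_ops"

text \<open>
  The image of \<open>T - l I\<close> in the Calkin algebra is its coset modulo the compact operators;
  \<open>l\<close> belongs to the spectrum of the image of \<open>T\<close> iff this coset is not a unit.
\<close>

definition ess_spectrum :: "('a::complex_hilbert \<Rightarrow> 'a) \<Rightarrow> complex set"
  where "ess_spectrum T =
    {l. compact_ops +>\<^bsub>op_ring\<^esub> (\<lambda>x. T x - l *\<^sub>C x) \<notin> Units calkin}"

text \<open>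
  Minimum and maximum of the essential spectrum as real numbers. For selfadjoint \<open>T\<close> on an
  infinite-dimensional space the essential spectrum is a nonempty compact set of reals, so
  both exist.
\<close>

definition min_ess_spectrum :: "('a::complex_hilbert \<Rightarrow> 'a) \<Rightarrow> real"
  where "min_ess_spectrum T = (LEAST c. complex_of_real c \<in> ess_spectrum T)"

definition max_ess_spectrum :: "('a::complex_hilbert \<Rightarrow> 'a) \<Rightarrow> real"
  where "max_ess_spectrum T = (GREATEST c. complex_of_real c \<in> ess_spectrum T)"


subsection \<open>The quotient is a ring\<close>

lemma bounded_op_zero: "bounded_op (\<lambda>x. 0)"
  by (simp add: bounded_op_def)

lemma bounded_op_id: "bounded_op id"
  by (simp add: bounded_op_def id_def)

lemma bounded_op_add: "bounded_op S \<Longrightarrow> bounded_op T \<Longrightarrow> bounded_op (\<lambda>x. S x + T x)"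
  by (simp add: bounded_op_def bounded_linear_add scaleC_add_right)

lemma bounded_op_uminus: "bounded_op T \<Longrightarrow> bounded_op (\<lambda>x. - T x)"
  by (simp add: bounded_op_def bounded_linear_minus complex_vector.scale_minus_right)

lemma bounded_op_comp: "bounded_op S \<Longrightarrow> bounded_op T \<Longrightarrow> bounded_op (S \<circ> T)"
  using bounded_linear_compose[of S T] by (simp add: bounded_op_def comp_def)

lemma norm_scaleC: "norm (a *\<^sub>C x) = cmod a * norm x"
proof -
  have "cinner (a *\<^sub>C x) (a *\<^sub>C x) = (a * cnj a) * cinner x x"
    by (simp add: cinner_scaleC_left) (subst cinner_commute, simp add: cinner_scaleC_left cinner_self)
  then have "complex_of_real ((norm (a *\<^sub>C x))\<^sup>2) = complex_of_real ((cmod a * norm x)\<^sup>2)"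
    by (simp add: cinner_self complex_norm_square[symmetric] power_mult_distrib)
  then have "(norm (a *\<^sub>C x))\<^sup>2 = (cmod a * norm x)\<^sup>2"
    by (simp only: of_real_eq_iff)
  then show ?thesis
    by simp
qed

lemma bounded_op_scaleC: "bounded_op (\<lambda>x :: 'a::complex_hilbert. a *\<^sub>C x)"
  unfolding bounded_op_def
proof (intro conjI allI)
  have "a *\<^sub>C (r *\<^sub>R x) = r *\<^sub>R (a *\<^sub>C x)" for r and x :: 'a
    by (simp add: scaleC_of_real[symmetric] scaleC_scaleC mult.commute)
  then show "bounded_linear (\<lambda>x :: 'a. a *\<^sub>C x)"
    by (intro bounded_linear_intro[where K = "cmod a"])
      (simp_all add: scaleC_add_right norm_scaleC mult.commute)
qed (simp add: scaleC_scaleC mult.commute)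

lemma bounded_op_shift: "bounded_op T \<Longrightarrow> bounded_op (\<lambda>x. T x - l *\<^sub>C x)"
  using bounded_op_add[of T, OF _ bounded_op_uminus[OF bounded_op_scaleC[of l]]] by simp

lemma ring_op_ring: "ring (op_ring :: ('a::complex_hilbert \<Rightarrow> 'a) ring)"
proof (rule ringI)
  show "abelian_group (op_ring :: ('a \<Rightarrow> 'a) ring)"
  proof (rule abelian_groupI)
    fix T :: "'a \<Rightarrow> 'a" assume "T \<in> carrier op_ring"
    then have "(\<lambda>x. - T x) \<in> carrier op_ring" "(\<lambda>x. - T x) \<oplus>\<^bsub>op_ring\<^esub> T = \<zero>\<^bsub>op_ring\<^esub>"
      by (auto simp: op_ring_def bounded_op_uminus)
    then show "\<exists>S\<in>carrier op_ring. S \<oplus>\<^bsub>op_ring\<^esub> T = \<zero>\<^bsub>op_ring\<^esub>"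
      by blast
  qed (auto simp: op_ring_def bounded_op_zero bounded_op_add algebra_simps)
  show "Group.monoid (op_ring :: ('a \<Rightarrow> 'a) ring)"
    by (rule monoidI) (auto simp: op_ring_def bounded_op_id bounded_op_comp comp_assoc)
qed (auto simp: op_ring_def bounded_op_def fun_eq_iff linear_add bounded_linear.linear)

lemma compact_ops_iff:
  "K \<in> compact_ops \<longleftrightarrow> bounded_op K \<and> (\<exists>C. compact C \<and> K ` cball 0 1 \<subseteq> C)"
proof
  assume "K \<in> compact_ops"
  then show "bounded_op K \<and> (\<exists>C. compact C \<and> K ` cball 0 1 \<subseteq> C)"
    using closure_subset[of "K ` cball 0 1"] unfolding compact_ops_def mem_Collect_eq by metis
next
  assume "bounded_op K \<and> (\<exists>C. compact C \<and> K ` cball 0 1 \<subseteq> C)"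
  then obtain C where K: "bounded_op K" and C: "compact C" "K ` cball 0 1 \<subseteq> C"
    by blast
  then have "closure (K ` cball 0 1) \<subseteq> C"
    by (simp add: closure_minimal compact_imp_closed)
  then have "closure (K ` cball 0 1) = C \<inter> closure (K ` cball 0 1)"
    by blast
  then have "compact (closure (K ` cball 0 1))"
    using compact_Int_closed[OF C(1) closed_closure] by metis
  with K show "K \<in> compact_ops"
    by (simp add: compact_ops_def)
qed

lemma compact_ops_add:
  assumes "K \<in> compact_ops" "L \<in> compact_ops"
  shows "(\<lambda>x. K x + L x) \<in> compact_ops"
proof -
  obtain C D where C: "compact C" "K ` cball 0 1 \<subseteq> C" and D: "compact D" "L ` cball 0 1 \<subseteq> D"
    using assms by (auto simp: compact_ops_iff)
  have "compact {x + y | x y. x \<in> C \<and> y \<in> D}"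
    by (rule compact_sums[OF C(1) D(1)])
  moreover have "(\<lambda>x. K x + L x) ` cball 0 1 \<subseteq> {x + y | x y. x \<in> C \<and> y \<in> D}"
    using C(2) D(2) by blast
  ultimately show ?thesis
    using assms bounded_op_add by (auto simp: compact_ops_iff)
qed

lemma compact_ops_left:
  assumes "bounded_op T" "K \<in> compact_ops"
  shows "T \<circ> K \<in> compact_ops"
proof -
  obtain C where C: "compact C" "K ` cball 0 1 \<subseteq> C"
    using assms by (auto simp: compact_ops_iff)
  have "compact (T ` C)"
    using assms(1) C(1)
    by (auto simp: bounded_op_def intro!: compact_continuous_image linear_continuous_on)
  moreover have "(T \<circ> K) ` cball 0 1 \<subseteq> T ` C"
    using C(2) by auto
  ultimately show ?thesis
    using assms bounded_op_comp[of T K] by (auto simp: compact_ops_iff)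
qed

lemma compact_ops_right:
  assumes "bounded_op T" "K \<in> compact_ops"
  shows "K \<circ> T \<in> compact_ops"
proof -
  obtain C where C: "compact C" "K ` cball 0 1 \<subseteq> C"
    using assms by (auto simp: compact_ops_iff)
  interpret T: bounded_linear T
    using assms(1) by (simp add: bounded_op_def)
  interpret K: bounded_linear K
    using assms(2) by (simp add: compact_ops_iff bounded_op_def)
  obtain b where b: "b > 0" "\<And>x. norm (T x) \<le> norm x * b"
    using T.pos_bounded by blast
  have "K (T x) \<in> (\<lambda>y. b *\<^sub>R y) ` C" if "norm x \<le> 1" for x
  proof -
    have "norm (T x) \<le> b"
      using order_trans[OF b(2)[of x] mult_right_mono[OF that, of b]] b(1) by simp
    then have "(1 / b) *\<^sub>R T x \<in> cball 0 1"
      using b(1) by (simp add: field_simps)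
    then have "K ((1 / b) *\<^sub>R T x) \<in> C"
      using C(2) by blast
    moreover have "K (T x) = b *\<^sub>R K ((1 / b) *\<^sub>R T x)"
      using b(1) by (simp add: K.scaleR)
    ultimately show ?thesis
      by blast
  qed
  then have "(K \<circ> T) ` cball 0 1 \<subseteq> (\<lambda>y. b *\<^sub>R y) ` C"
    by auto
  moreover have "compact ((\<lambda>y. b *\<^sub>R y) ` C)"
    by (rule compact_scaling[OF C(1)])
  ultimately show ?thesis
    using assms bounded_op_comp[of K T] by (auto simp: compact_ops_iff)
qed

lemma compact_ops_zero: "(\<lambda>x. 0) \<in> compact_ops"
  unfolding compact_ops_iff by (auto simp: bounded_op_zero intro!: exI[of _ "{0}"])

lemma compact_ops_uminus:
  assumes "K \<in> compact_ops"
  shows "(\<lambda>x. - K x) \<in> compact_ops"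
  using compact_ops_left[OF bounded_op_uminus[OF bounded_op_id] assms] by (simp add: comp_def)

lemma op_ring_a_inv:
  assumes "bounded_op T"
  shows "\<ominus>\<^bsub>op_ring\<^esub> T = (\<lambda>x. - T x)"
proof -
  interpret ring "op_ring :: ('a \<Rightarrow> 'a) ring"
    by (rule ring_op_ring)
  show ?thesis
    by (rule minus_equality) (use assms in \<open>auto simp: op_ring_def bounded_op_uminus\<close>)
qed

lemma ideal_compact_ops: "ideal compact_ops (op_ring :: ('a::complex_hilbert \<Rightarrow> 'a) ring)"
proof (rule idealI)
  interpret ring "op_ring :: ('a \<Rightarrow> 'a) ring"
    by (rule ring_op_ring)
  show "ring (op_ring :: ('a \<Rightarrow> 'a) ring)"
    by (rule ring_op_ring)
  show "subgroup compact_ops (add_monoid (op_ring :: ('a \<Rightarrow> 'a) ring))"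
  proof (rule add.subgroupI)
    show "compact_ops \<noteq> ({} :: ('a \<Rightarrow> 'a) set)"
      using compact_ops_zero by blast
    show "\<ominus>\<^bsub>op_ring\<^esub> K \<in> compact_ops" if "K \<in> compact_ops" for K :: "'a \<Rightarrow> 'a"
      using that compact_ops_uminus[OF that] by (simp add: op_ring_a_inv compact_ops_iff)
  qed (use compact_ops_add in \<open>auto simp: op_ring_def compact_ops_iff\<close>)
qed (auto simp: op_ring_def compact_ops_left compact_ops_right)

lemma ring_calkin: "ring (calkin :: ('a::complex_hilbert \<Rightarrow> 'a) set ring)"
  unfolding calkin_def by (rule ideal.quotient_is_ring[OF ideal_compact_ops])

end

theory Submission
  imports Defs
begin

text \<open>
  Put \<open>q x = \<langle>T x, x\<rangle>\<close>, \<open>a = inf q\<close> and \<open>b = sup q\<close> over the unit sphere. Since \<open>W(T) \<subseteq> W\<^sub>e(T)\<close>, both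
  \<open>a\<close> and \<open>b\<close> have approximate eigenvectors orthogonal to any given finite set; hence they are the
  extreme points of the essential spectrum, and \<open>W\<^sub>e(T)\<close> lies between \<open>(a, b)\<close> and \<open>[a, b]\<close>.

  Sufficiency: entries equal to \<open>a\<close> or \<open>b\<close> are realised by eigenvectors. For each other entry
  \<open>d\<^sub>n\<close> pick a target \<open>z\<close> from a dense sequence, let \<open>u\<close> be its normalised component orthogonal to
  the vectors chosen so far, and take \<open>e\<^sub>n\<close> to be a combination of \<open>u\<close> and some unit \<open>w\<close> orthogonal
  to \<open>u\<close> and \<open>T u\<close> such that \<open>q e\<^sub>n = d\<^sub>n\<close>. With \<open>q w\<close> halfway between \<open>d\<^sub>n\<close> and an endpoint, the squared
  distance from \<open>z\<close> to the span shrinks by a factor \<open>1 - c dist(d\<^sub>n, {a, b})\<close>. If every target is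
  served by a divergent part of the series, all distances tend to \<open>0\<close> and the vectors form a basis.

  Necessity of the divergence: otherwise \<open>(T - a)(T - b)\<close> is a Hilbert-Schmidt operator, and
  the essential spectrum is contained in \<open>{a, b}\<close>.
\<close>

section \<open>Geometry of complex Hilbert spaces\<close>

lemma cinner_add_right: "cinner x (y + z) = cinner x y + cinner x (z :: 'a::complex_hilbert)"
  by (subst (1 2 3) cinner_commute) (simp add: cinner_add_left)

lemma cinner_scaleC_right: "cinner x (a *\<^sub>C y) = cnj a * cinner x (y :: 'a::complex_hilbert)"
  by (subst (1 2) cinner_commute) (simp add: cinner_scaleC_left)

lemma cinner_zero [simp]:
  "cinner 0 (x :: 'a::complex_hilbert) = 0" "cinner (x :: 'a::complex_hilbert) 0 = 0"
  using cinner_add_left[of 0 0 x] cinner_add_right[of x 0 0] by simp_all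

lemma cinner_minus:
  "cinner (- x) y = - cinner x y" "cinner x (- y) = - cinner x (y :: 'a::complex_hilbert)"
  using cinner_add_left[of x "- x" y] cinner_add_right[of x y "- y"]
  by (simp_all add: eq_neg_iff_add_eq_0 add.commute)

lemma cinner_diff_left: "cinner (x - y) z = cinner x z - cinner y (z :: 'a::complex_hilbert)"
  using cinner_add_left[of x "- y" z] by (simp add: cinner_minus)

lemma cinner_diff_right: "cinner x (y - z) = cinner x y - cinner x (z :: 'a::complex_hilbert)"
  using cinner_add_right[of x y "- z"] by (simp add: cinner_minus)

lemma cinner_sum_left: "cinner (sum f A) z = (\<Sum>i\<in>A. cinner (f i) (z :: 'a::complex_hilbert))"
  by (induction A rule: infinite_finite_induct) (simp_all add: cinner_add_left)

lemmas cinner_simps = cinner_add_left cinner_add_right cinner_diff_left cinner_diff_right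
  cinner_minus cinner_scaleC_left cinner_scaleC_right

lemma cinner_eq_0_commute: "cinner x y = 0 \<longleftrightarrow> cinner y (x :: 'a::complex_hilbert) = 0"
  by (subst cinner_commute) simp

lemma scaleC_one [simp]: "1 *\<^sub>C (x :: 'a::complex_hilbert) = x"
  using scaleC_of_real[of 1 x] by simp

lemma norm_eq_1_cinner: "norm (x :: 'a::complex_hilbert) = 1 \<longleftrightarrow> cinner x x = 1"
proof -
  have "cinner x x = 1 \<longleftrightarrow> (norm x)\<^sup>2 = 1"
    unfolding cinner_self by (simp only: of_real_eq_1_iff)
  then show ?thesis
    using norm_ge_zero[of x] by (auto simp: power2_eq_1_iff)
qed

lemma cinner_scaleR_left:
  "cinner (r *\<^sub>R x) y = complex_of_real r * cinner x (y :: 'a::complex_hilbert)"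
  using cinner_scaleC_left[of "complex_of_real r"] by (simp add: scaleC_of_real)

lemma cinner_scaleR_right:
  "cinner x (r *\<^sub>R y) = complex_of_real r * cinner x (y :: 'a::complex_hilbert)"
  using cinner_scaleC_right[of x "complex_of_real r"] by (simp add: scaleC_of_real)

text \<open>The real Cauchy-Schwarz inequality sees only the real part. Multiplying \<open>x\<close>
  by the unimodular \<open>u\<close> rotates \<open>cinner x y\<close> onto its modulus, where both
  agree.\<close>

lemma cinner_norm_le: "cmod (cinner x y) \<le> norm x * norm (y :: 'a::complex_hilbert)"
proof (cases "cinner x y = 0")
  case False
  define z where "z = cinner x y"
  define u where "u = cnj z / complex_of_real (cmod z)"
  have "cmod u = 1"
    using False by (simp add: u_def z_def norm_divide)
  have "u * z = (z * cnj z) / complex_of_real (cmod z)"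
    by (simp add: u_def)
  also have "\<dots> = complex_of_real (cmod z)"
    by (simp flip: complex_norm_square) (simp add: power2_eq_square)
  finally have "cinner (u *\<^sub>C x) y = complex_of_real (cmod (cinner x y))"
    by (simp add: cinner_scaleC_left z_def)
  then have "cmod (cinner x y) = inner (u *\<^sub>C x) y"
    by (simp flip: Re_cinner)
  also have "\<dots> \<le> norm (u *\<^sub>C x) * norm y"
    by (rule norm_cauchy_schwarz)
  finally show ?thesis
    using \<open>cmod u = 1\<close> by (simp add: norm_scaleC)
qed auto

lemma bounded_bilinear_cinner:
  "bounded_bilinear (cinner :: 'a::complex_hilbert \<Rightarrow> 'a \<Rightarrow> complex)"
  by (rule bounded_bilinear.intro)
    (auto simp: cinner_simps cinner_scaleR_left cinner_scaleR_right scaleR_conv_of_real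
      intro!: exI[of _ 1] cinner_norm_le)

lemmas tendsto_cinner [tendsto_intros] = bounded_bilinear.tendsto[OF bounded_bilinear_cinner]

lemma pythagoras:
  fixes x y :: "'a::complex_hilbert"
  assumes "cinner x y = 0"
  shows "(norm (x + y))\<^sup>2 = (norm x)\<^sup>2 + (norm y)\<^sup>2"
proof -
  have "inner x y = 0"
    using assms by (simp flip: Re_cinner)
  then show ?thesis
    by (simp add: power2_norm_eq_inner inner_simps inner_commute)
qed

lemma orthogonal_cspan:
  fixes x :: "'a::complex_hilbert"
  assumes "\<And>s. s \<in> S \<Longrightarrow> cinner x s = 0" "y \<in> cspan S"
  shows "cinner x y = 0"
  using assms(2)
  by (induction rule: complex_vector.span_induct_alt) (auto simp: cinner_simps assms(1))

lemma closure_cspan_add: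
  fixes x y :: "'a::complex_hilbert"
  assumes "x \<in> closure (cspan S)" "y \<in> closure (cspan S)"
  shows "x + y \<in> closure (cspan S)"
proof -
  obtain u v where "\<And>n. u n \<in> cspan S" "u \<longlonglongrightarrow> x" "\<And>n. v n \<in> cspan S" "v \<longlonglongrightarrow> y"
    using assms by (auto simp: closure_sequential)
  then show ?thesis
    unfolding closure_sequential
    by (intro exI[of _ "\<lambda>n. u n + v n"]) (auto intro: tendsto_add complex_vector.span_add)
qed

section \<open>Orthogonality to finitely many vectors\<close>

text \<open>Gram-Schmidt: the new vector \<open>s\<close> is replaced by \<open>w\<close>, its
  component orthogonal to \<open>S\<close>, so that a correction along \<open>w\<close> preserves
  the orthogonality to \<open>S\<close> already achieved.\<close>

lemma finite_projection:
  fixes x :: "'a::complex_hilbert"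
  assumes "finite S"
  shows "\<exists>p\<in>cspan S. \<forall>s\<in>S. cinner (x - p) s = 0"
  using assms
proof (induction arbitrary: x rule: finite_induct)
  case empty
  show ?case
    by (auto intro: complex_vector.span_zero)
next
  case (insert s S)
  obtain p where p: "p \<in> cspan S" "\<And>t. t \<in> S \<Longrightarrow> cinner (s - p) t = 0"
    using insert.IH[of s] by blast
  obtain q where q: "q \<in> cspan S" "\<And>t. t \<in> S \<Longrightarrow> cinner (x - q) t = 0"
    using insert.IH[of x] by blast
  define w where "w = s - p"
  define c where "c = cinner (x - q) w / cinner w w"
  have sub: "cspan S \<subseteq> cspan (insert s S)"
    by (rule complex_vector.span_mono) auto
  have "s \<in> cspan (insert s S)"
    by (simp add: complex_vector.span_base)
  then have w: "w \<in> cspan (insert s S)"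
    unfolding w_def using p(1) sub by (blast intro: complex_vector.span_diff)
  \<comment> \<open>If \<open>s\<close> lies in the span of \<open>S\<close>, then
    \<open>w = 0\<close>, division by zero makes \<open>c = 0\<close>, and no correction takes
    place.\<close>
  have "cinner (x - (q + c *\<^sub>C w)) w = 0"
    by (cases "w = 0") (auto simp: cinner_simps c_def cinner_self)
  moreover have "cinner (x - (q + c *\<^sub>C w)) t = 0" if "t \<in> S" for t
    using q(2)[OF that] p(2)[OF that] by (simp add: cinner_simps w_def algebra_simps)
  moreover from this have "cinner (x - (q + c *\<^sub>C w)) p = 0"
    by (rule orthogonal_cspan[OF _ p(1)])
  ultimately have "\<forall>t\<in>insert s S. cinner (x - (q + c *\<^sub>C w)) t = 0"
    by (auto simp: w_def cinner_diff_right)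
  moreover have "q + c *\<^sub>C w \<in> cspan (insert s S)"
    using w q(1) sub by (blast intro: complex_vector.span_add complex_vector.span_scale)
  ultimately show ?case
    by blast
qed

text \<open>Subtracting its projection from a vector of \<open>V\<close> outside
  \<open>cspan S\<close> leaves something nonzero; \<open>S \<subseteq> V\<close> keeps the
  difference inside \<open>V\<close>.\<close>

lemma unit_vector_orthogonal_finite:
  fixes V :: "'a::complex_hilbert set"
  assumes V: "complex_vector.subspace V" "\<not> V \<subseteq> cspan S" and S: "finite S" "S \<subseteq> V"
  shows "\<exists>v\<in>V. norm v = 1 \<and> (\<forall>s\<in>S. cinner v s = 0)"
proof -
  obtain x where x: "x \<in> V" "x \<notin> cspan S"
    using V(2) by blast
  obtain p where p: "p \<in> cspan S" "\<And>s. s \<in> S \<Longrightarrow> cinner (x - p) s = 0"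
    using finite_projection[OF S(1), of x] by blast
  define w where "w = x - p"
  have "p \<in> V"
    using p(1) S(2) V(1) complex_vector.span_minimal by blast
  then have "w \<in> V"
    unfolding w_def using x(1) V(1) complex_vector.subspace_diff by blast
  then have "(1 / norm w) *\<^sub>R w \<in> V"
    using V(1) by (metis complex_vector.subspace_scale scaleC_of_real)
  moreover have "w \<noteq> 0"
    using x p(1) by (auto simp: w_def)
  ultimately show ?thesis
    using p(2) by (intro bexI[of _ "(1 / norm w) *\<^sub>R w"]) (auto simp: cinner_scaleR_left w_def)
qed

lemma orthonormal_independent:
  fixes x :: "'b \<Rightarrow> 'a::complex_hilbert"
  assumes x: "\<And>i j. i \<in> A \<Longrightarrow> j \<in> A \<Longrightarrow> cinner (x i) (x j) = (if i = j then 1 else 0)"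
  shows "complex_vector.independent (x ` A)"
  unfolding complex_vector.dependent_def
proof
  assume "\<exists>v\<in>x ` A. v \<in> cspan (x ` A - {v})"
  then obtain i where i: "i \<in> A" "x i \<in> cspan (x ` A - {x i})"
    by blast
  have "cinner (x i) z = 0" if "z \<in> x ` A - {x i}" for z
    using that x[OF i(1)] by auto
  then have "cinner (x i) (x i) = 0"
    by (rule orthogonal_cspan[OF _ i(2)])
  then show False
    using x[OF i(1) i(1)] by simp
qed

text \<open>
  A finite set \<open>N\<close> outside the span \<open>W\<close> of the first \<open>card N + 1\<close> vectors is handled by
  projecting \<open>N\<close> onto \<open>W\<close>, where it cannot span for dimension reasons.
\<close>

lemma unit_vector_in_span_orthogonal_finite:
  fixes x :: "nat \<Rightarrow> 'a::complex_hilbert"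
  assumes x: "\<And>i j. cinner (x i) (x j) = (if i = j then 1 else 0)" and N: "finite N"
  shows "\<exists>v\<in>cspan (x ` {..card N}). norm v = 1 \<and> (\<forall>s\<in>N. cinner v s = 0)"
proof -
  define W where "W = cspan (x ` {..card N})"
  have "\<forall>s. \<exists>p\<in>W. \<forall>w\<in>x ` {..card N}. cinner (s - p) w = 0"
    unfolding W_def by (intro allI finite_projection) auto
  then obtain P where P: "\<And>s. P s \<in> W" "\<And>s w. w \<in> x ` {..card N} \<Longrightarrow> cinner (s - P s) w = 0"
    by metis
  have "inj x"
  proof (rule injI)
    fix i j assume "x i = x j"
    then show "i = j"
      using x[of i j] x[of j j] by (auto split: if_splits)
  qed
  then have card: "card (x ` {..card N}) = Suc (card N)"
    using inj_on_subset[OF \<open>inj x\<close> subset_UNIV] by (simp add: card_image)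
  have indep: "complex_vector.independent (x ` {..card N})"
    by (rule orthonormal_independent) (rule x)
  have "\<not> W \<subseteq> cspan (P ` N)"
  proof
    assume "W \<subseteq> cspan (P ` N)"
    then have "x ` {..card N} \<subseteq> cspan (P ` N)"
      unfolding W_def by (rule order_trans[OF complex_vector.span_superset])
    from complex_vector.independent_span_bound[OF _ indep this] N
    have "card (x ` {..card N}) \<le> card (P ` N)"
      by simp
    then show False
      using card card_image_le[OF N, of P] by simp
  qed
  then obtain v where v: "v \<in> W" "norm v = 1" "\<And>s. s \<in> N \<Longrightarrow> cinner v (P s) = 0"
    using unit_vector_orthogonal_finite[of W "P ` N"] N P(1) by (auto simp: W_def)
  have "cinner v s = 0" if "s \<in> N" for s
  proof -
    have "cinner (s - P s) v = 0"
      using orthogonal_cspan[of "x ` {..card N}" "s - P s" v] P(2) v(1) unfolding W_def by blast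
    then show ?thesis
      using v(3)[OF that] by (simp add: cinner_eq_0_commute[of _ v] cinner_diff_right)
  qed
  with v show ?thesis
    unfolding W_def by blast
qed

section \<open>Orthonormal expansions, Bessel's inequality and closed spans\<close>

definition partial_expansion :: "'a::complex_hilbert \<Rightarrow> (nat \<Rightarrow> 'a) \<Rightarrow> nat \<Rightarrow> 'a"
  where "partial_expansion x g n = (\<Sum>k<n. cinner x (g k) *\<^sub>C g k)"

lemma partial_expansion_in_cspan: "partial_expansion x g n \<in> cspan (g ` {..<n})"
  unfolding partial_expansion_def
  by (intro complex_vector.span_sum complex_vector.span_scale complex_vector.span_base) auto

lemma partial_expansion_cong:
  "(\<And>k. k < n \<Longrightarrow> g k = h k) \<Longrightarrow> partial_expansion x g n = partial_expansion x h n"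
  by (simp add: partial_expansion_def)

text \<open>
  Zero vectors are allowed, so that the lemmas below also cover families indexed by a subset
  of \<open>nat\<close>.
\<close>

definition orthonormal_upto :: "(nat \<Rightarrow> 'a::complex_hilbert) \<Rightarrow> nat \<Rightarrow> bool"
  where "orthonormal_upto g n \<longleftrightarrow>
    (\<forall>i<n. \<forall>j<n. i \<noteq> j \<longrightarrow> cinner (g i) (g j) = 0) \<and> (\<forall>i<n. norm (g i) = 1 \<or> g i = 0)"

lemma orthonormal_upto_mono: "orthonormal_upto g n \<Longrightarrow> m \<le> n \<Longrightarrow> orthonormal_upto g m"
  by (auto simp: orthonormal_upto_def)

lemma partial_expansion_residual_orthogonal:
  assumes "orthonormal_upto g n" "k < n"
  shows "cinner (x - partial_expansion x g n) (g k) = 0"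
proof -
  have *: "cinner (g k) (g k) = 1 \<or> g k = 0"
    using assms by (auto simp: orthonormal_upto_def cinner_self)
  have "cinner (partial_expansion x g n) (g k) =
      (\<Sum>i<n. if i = k then cinner x (g k) * cinner (g k) (g k) else 0)"
    unfolding partial_expansion_def cinner_sum_left
    using assms by (intro sum.cong) (auto simp: cinner_scaleC_left orthonormal_upto_def)
  also have "\<dots> = cinner x (g k)"
    using assms(2) * by auto
  finally show ?thesis
    by (simp add: cinner_diff_left)
qed

text \<open>Pythagoras: the old residual is the sum of the new one and an orthogonal multiple of
  \<open>g n\<close>. The identity telescopes to Bessel's inequality and later measures how much
  each new basis vector gains on a target.\<close>

lemma partial_expansion_residual_Suc:
  assumes "orthonormal_upto g (Suc n)"
  shows "(norm (x - partial_expansion x g (Suc n)))\<^sup>2 =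
    (norm (x - partial_expansion x g n))\<^sup>2 - (cmod (cinner (x - partial_expansion x g n) (g n)))\<^sup>2"
    (is "(norm ?s)\<^sup>2 = (norm ?r)\<^sup>2 - _")
    and "cinner (x - partial_expansion x g n) (g n) = cinner x (g n)"
proof -
  have "cinner (g n) (partial_expansion x g n) = 0"
    using assms by (intro orthogonal_cspan[OF _ partial_expansion_in_cspan])
      (auto simp: orthonormal_upto_def)
  then show *: "cinner ?r (g n) = cinner x (g n)"
    by (simp add: cinner_diff_left cinner_eq_0_commute[of "partial_expansion x g n"])
  have r: "?r = ?s + cinner x (g n) *\<^sub>C g n"
    by (simp add: partial_expansion_def)
  have "cinner ?s (g n) = 0"
    using partial_expansion_residual_orthogonal[OF assms, of n] by simp
  then have "(norm ?r)\<^sup>2 = (norm ?s)\<^sup>2 + (norm (cinner x (g n) *\<^sub>C g n))\<^sup>2"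
    unfolding r by (intro pythagoras) (simp add: cinner_scaleC_right)
  moreover have "norm (cinner x (g n) *\<^sub>C g n) = cmod (cinner x (g n))"
    using assms by (auto simp: norm_scaleC orthonormal_upto_def)
  ultimately show "(norm ?s)\<^sup>2 = (norm ?r)\<^sup>2 - (cmod (cinner ?r (g n)))\<^sup>2"
    unfolding * by simp
qed

lemma bessel_inequality:
  assumes "orthonormal_upto g n"
  shows "(\<Sum>k<n. (cmod (cinner x (g k)))\<^sup>2) \<le> (norm x)\<^sup>2"
proof -
  have "(\<Sum>k<m. (cmod (cinner x (g k)))\<^sup>2) = (norm x)\<^sup>2 - (norm (x - partial_expansion x g m))\<^sup>2"
    if "m \<le> n" for m
    using that
  proof (induction m)
    case 0
    show ?case
      by (simp add: partial_expansion_def)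
  next
    case (Suc m)
    then have "orthonormal_upto g (Suc m)"
      using orthonormal_upto_mono[OF assms] by simp
    from partial_expansion_residual_Suc[OF this, of x] Suc show ?case
      by simp
  qed
  then show ?thesis
    by simp
qed

text \<open>The squared residual norms \<open>s\<close> decrease and hence converge. By Pythagoras
  the squared distance of two partial expansions is a difference of two values of \<open>s\<close>,
  so the expansions form a Cauchy sequence.\<close>

lemma partial_expansion_convergent:
  fixes x :: "'a::complex_hilbert"
  assumes g: "\<And>n. orthonormal_upto g n"
  shows "\<exists>p. partial_expansion x g \<longlonglongrightarrow> p \<and> p \<in> closure (cspan (range g)) \<and>
    (\<forall>k. cinner (x - p) (g k) = 0)"
proof -
  define S where "S = partial_expansion x g"
  define s where "s n = (norm (x - S n))\<^sup>2" for n
  have mono: "s m = s n + (norm (S n - S m))\<^sup>2" if "m \<le> n" for m n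
  proof -
    have "cspan (g ` {..<m}) \<subseteq> cspan (g ` {..<n})"
      using that by (intro complex_vector.span_mono) auto
    then have mem: "S n - S m \<in> cspan (g ` {..<n})"
      unfolding S_def using partial_expansion_in_cspan[of x g]
      by (intro complex_vector.span_diff) auto
    have zero: "cinner (x - S n) z = 0" if "z \<in> g ` {..<n}" for z
      unfolding S_def using partial_expansion_residual_orthogonal[OF g] that by auto
    have "cinner (x - S n) (S n - S m) = 0"
      by (rule orthogonal_cspan[OF zero mem])
    from pythagoras[OF this] show ?thesis
      by (simp add: s_def)
  qed
  have "decseq s"
  proof (rule decseq_SucI)
    show "s (Suc n) \<le> s n" for n
      using mono[of n "Suc n"] by simp
  qed
  moreover have "\<forall>i. 0 \<le> s i"
    by (simp add: s_def)
  ultimately obtain L where "s \<longlonglongrightarrow> L"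
    by (rule decseq_convergent)
  then have "convergent s"
    by (rule convergentI)
  then have "Cauchy s"
    by (rule convergent_Cauchy)
  have "Cauchy S"
  proof (rule CauchyI)
    fix e :: real assume "e > 0"
    then obtain M where M: "\<And>m n. m \<ge> M \<Longrightarrow> n \<ge> M \<Longrightarrow> norm (s m - s n) < e\<^sup>2"
      using CauchyD[OF \<open>Cauchy s\<close>, of "e\<^sup>2"] by auto
    have le: "norm (S m - S n) < e" if "m \<ge> M" "n \<ge> M" "m \<le> n" for m n
    proof -
      have "(norm (S n - S m))\<^sup>2 < e\<^sup>2"
        using M[OF that(1,2)] unfolding mono[OF that(3)] by simp
      then show ?thesis
        using \<open>e > 0\<close> norm_minus_commute[of "S m" "S n"] power_less_imp_less_base[of _ 2 e] by simp
    qed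
    then have "norm (S m - S n) < e" if "m \<ge> M" "n \<ge> M" for m n
      using le[OF that] le[OF that(2,1)] norm_minus_commute[of "S m" "S n"] by linarith
    then show "\<exists>M. \<forall>m\<ge>M. \<forall>n\<ge>M. norm (S m - S n) < e"
      by blast
  qed
  then obtain p where p: "S \<longlonglongrightarrow> p"
    by (auto simp: Cauchy_convergent_iff convergent_def)
  have "S n \<in> cspan (range g)" for n
    unfolding S_def using partial_expansion_in_cspan[of x g n]
      complex_vector.span_mono[of "g ` {..<n}" "range g"] by blast
  with p have "p \<in> closure (cspan (range g))"
    unfolding closure_sequential by (intro exI[of _ S]) simp
  moreover have "cinner (x - p) (g k) = 0" for k
  proof (rule LIMSEQ_unique)
    show "(\<lambda>n. cinner (x - S n) (g k)) \<longlonglongrightarrow> cinner (x - p) (g k)"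
      by (intro tendsto_intros p)
    have "cinner (x - S n) (g k) = 0" if "n \<ge> Suc k" for n
      unfolding S_def using partial_expansion_residual_orthogonal[OF g] that by auto
    then show "(\<lambda>n. cinner (x - S n) (g k)) \<longlonglongrightarrow> 0"
      by (intro tendsto_eventually eventually_sequentiallyI)
  qed
  ultimately show ?thesis
    using p unfolding S_def by blast
qed

lemma closed_span_projection:
  fixes x :: "'a::complex_hilbert" and f :: "nat \<Rightarrow> 'a"
  assumes f: "\<And>i j. i \<in> K \<Longrightarrow> j \<in> K \<Longrightarrow> cinner (f i) (f j) = (if i = j then 1 else 0)"
  obtains p where "p \<in> closure (cspan (f ` K))" "\<And>k. k \<in> K \<Longrightarrow> cinner (x - p) (f k) = 0"
proof -
  \<comment> \<open>Padding by zero turns a family over an arbitrary index set into a sequence with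
    the same span, to which the convergence result applies.\<close>
  define g where "g k = (if k \<in> K then f k else 0)" for k
  have "\<And>n. orthonormal_upto g n"
    by (auto simp: orthonormal_upto_def g_def f norm_eq_1_cinner)
  from partial_expansion_convergent[OF this, of x]
  obtain p where p: "p \<in> closure (cspan (range g))" "\<forall>k. cinner (x - p) (g k) = 0"
    by blast
  have "range g \<subseteq> cspan (f ` K)"
    by (auto simp: g_def complex_vector.span_base complex_vector.span_zero)
  then have "cspan (range g) \<subseteq> cspan (f ` K)"
    by (rule complex_vector.span_minimal[OF _ complex_vector.subspace_span])
  from subsetD[OF closure_mono[OF this] p(1)] have "p \<in> closure (cspan (f ` K))" .
  moreover have "cinner (x - p) (f k) = 0" if "k \<in> K" for k
    using spec[OF p(2), of k] that by (simp add: g_def)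
  ultimately show ?thesis
    by (rule that)
qed

lemma orthonormal_basis_norm: "orthonormal_basis e \<Longrightarrow> norm (e n) = 1"
  by (simp add: orthonormal_basis_def norm_eq_1_cinner)

lemma orthonormal_basis_upto: "orthonormal_basis e \<Longrightarrow> orthonormal_upto e n"
  by (simp add: orthonormal_upto_def orthonormal_basis_norm) (simp add: orthonormal_basis_def)

lemma orthogonal_dense_zero:
  fixes x :: "'a::complex_hilbert"
  assumes "closure (cspan S) = UNIV" "\<And>s. s \<in> S \<Longrightarrow> cinner x s = 0"
  shows "x = 0"
proof -
  have "x \<in> closure (cspan S)"
    using assms(1) by simp
  then obtain u where u: "\<And>n. u n \<in> cspan S" "u \<longlonglongrightarrow> x"
    unfolding closure_sequential by blast
  have "(\<lambda>n. cinner x (u n)) \<longlonglongrightarrow> cinner x x"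
    by (intro tendsto_intros u)
  moreover have "cinner x (u n) = 0" for n
    using orthogonal_cspan[OF assms(2) u(1)] .
  ultimately have "cinner x x = 0"
    by (simp add: LIMSEQ_const_iff)
  then show ?thesis
    by (simp add: cinner_self)
qed

lemma orthonormal_basis_expansion:
  assumes "orthonormal_basis e"
  shows "partial_expansion x e \<longlonglongrightarrow> x"
proof -
  obtain p where p: "partial_expansion x e \<longlonglongrightarrow> p" "\<forall>k. cinner (x - p) (e k) = 0"
    using partial_expansion_convergent[OF orthonormal_basis_upto[OF assms], of x] by blast
  have "x - p = 0"
    using assms p(2) by (intro orthogonal_dense_zero[of "range e"]) (auto simp: orthonormal_basis_def)
  with p(1) show ?thesis
    by simp
qed

section \<open>Bases with prescribed diagonal\<close>

text \<open>The range of the partial sums is cut into blocks of length \<open>2 * M\<close>, and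
  every index \<open>i\<close> owns infinitely many blocks. A single term is at most
  \<open>M\<close>, so the sum enters each block in its lower half and gains at least
  \<open>M\<close> before leaving it; this violates the Cauchy criterion for every
  \<open>i\<close>.\<close>

lemma divergent_partition:
  fixes w :: "nat \<Rightarrow> real"
  assumes nn: "\<And>n. 0 \<le> w n" and bd: "\<And>n. w n \<le> M" and div: "\<not> summable w"
  obtains j :: "nat \<Rightarrow> nat" where "\<And>i. \<not> summable (\<lambda>n. if j n = i then w n else 0)"
proof -
  have "M > 0"
  proof (rule ccontr)
    assume "\<not> M > 0"
    then have "w n = 0" for n
      using nn[of n] bd[of n] by linarith
    then have "w = (\<lambda>n. 0)"
      by blast
    then show False
      using div by simp
  qed
  define S where "S n = sum w {..<n}" for n
  have S_mono: "S m \<le> S n" if "m \<le> n" for m n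
    unfolding S_def using that nn by (intro sum_mono2) auto
  have unbounded: "\<exists>n. c \<le> S n" for c
  proof (rule ccontr)
    assume "\<nexists>n. c \<le> S n"
    then have "\<And>n. sum w {..<n} \<le> c"
      unfolding S_def by (meson linear)
    then show False
      using div summableI_nonneg_bounded[of w, OF nn] by blast
  qed
  \<comment> \<open>The floor is the number of the block that contains \<open>S n\<close>; its owner
    is the first component of the decoded pair.\<close>
  define j where "j n = fst (prod_decode (nat \<lfloor>S n / (2 * M)\<rfloor>))" for n
  have "\<not> summable (\<lambda>n. if j n = i then w n else 0)" for i
  proof
    assume "summable (\<lambda>n. if j n = i then w n else 0)"
    then obtain N where N:
      "\<And>m n. m \<ge> N \<Longrightarrow> norm (\<Sum>k=m..<n. if j k = i then w k else 0) < M"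
      unfolding summable_Cauchy using \<open>M > 0\<close> by blast
    \<comment> \<open>The second component \<open>k\<close> is free, so block \<open>m\<close>,
      owned by \<open>i\<close>, can be placed above \<open>S N\<close>.\<close>
    obtain k :: nat where k: "real k > S N / (2 * M)"
      using reals_Archimedean2 by blast
    define m where "m = prod_encode (i, k)"
    have "k \<le> m"
      unfolding m_def by (rule le_prod_encode_2)
    with k have "S N / (2 * M) < real m"
      by linarith
    then have m: "S N < 2 * M * m"
      using \<open>M > 0\<close> by (simp add: field_simps)
    \<comment> \<open>First indices at which the partial sums reach the lower and the upper end of
      block \<open>m\<close>.\<close>
    define n0 where "n0 = (LEAST n. 2 * M * m \<le> S n)"
    define n1 where "n1 = (LEAST n. 2 * M * (m + 1) \<le> S n)"
    have n0: "2 * M * m \<le> S n0"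
      unfolding n0_def by (rule LeastI_ex[OF unbounded])
    have n0_less: "S n < 2 * M * m" if "n < n0" for n
      using not_less_Least[OF that[unfolded n0_def]] by (simp only: not_le)
    have n1: "2 * M * (m + 1) \<le> S n1"
      unfolding n1_def by (rule LeastI_ex[OF unbounded])
    have n1_less: "S n < 2 * M * (m + 1)" if "n < n1" for n
      using not_less_Least[OF that[unfolded n1_def]] by (simp only: not_le)
    have "N < n0"
    proof (rule ccontr)
      assume "\<not> N < n0"
      then show False
        using m n0 S_mono[of n0 N] by linarith
    qed
    \<comment> \<open>One index earlier the sum was still below the block, so it overshoots the
      lower end by at most one term.\<close>
    then obtain n' where n': "n0 = Suc n'"
      by (cases n0) auto
    have "S n0 \<le> 2 * M * m + M"
      using n0_less[of n'] bd[of n'] by (simp add: n' S_def)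
    have "2 * M * m \<le> 2 * M * (m + 1)"
      using \<open>M > 0\<close> by simp
    then have "n0 \<le> n1"
      using n0_less[of n1] n1 by (meson leI le_less_trans not_le)
    have j: "j n = i" if "n0 \<le> n" "n < n1" for n
    proof -
      have "2 * M * m \<le> S n" "S n < 2 * M * (m + 1)"
        using n0 S_mono[OF that(1)] n1_less[OF that(2)] by auto
      then have "real m \<le> S n / (2 * M)" "S n / (2 * M) < real m + 1"
        using \<open>M > 0\<close> by (simp_all add: pos_le_divide_eq pos_divide_less_eq mult.commute add.commute)
      then have "\<lfloor>S n / (2 * M)\<rfloor> = int m"
        by (simp add: floor_eq_iff)
      then show ?thesis
        by (simp add: j_def m_def)
    qed
    have "(\<Sum>k=n0..<n1. if j k = i then w k else 0) = (\<Sum>k=n0..<n1. w k)"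
      using j by (intro sum.cong) auto
    also have "\<dots> = S n1 - S n0"
      using sum_diff_nat_ivl[of 0 n0 n1 w] \<open>n0 \<le> n1\<close> by (simp add: S_def atLeast0LessThan)
    also have "\<dots> \<ge> M"
      using n1 \<open>S n0 \<le> 2 * M * m + M\<close> by (simp add: algebra_simps)
    finally show False
      using N[of n0 n1] \<open>N < n0\<close> by simp
  qed
  then show ?thesis
    using that by blast
qed

text \<open>The sequence decreases to some \<open>L\<close>. If \<open>L > 0\<close>, step
  \<open>n\<close> loses at least \<open>L * w n\<close>, so the partial sums of \<open>w\<close>
  stay below \<open>u 0 / L\<close>.\<close>

lemma damped_sequence_tendsto_zero:
  fixes u w :: "nat \<Rightarrow> real"
  assumes u: "\<And>n. 0 \<le> u n" and w: "\<And>n. 0 \<le> w n" "\<not> summable w"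
    and step: "\<And>n. u (Suc n) \<le> u n - w n * u n"
  shows "u \<longlonglongrightarrow> 0"
proof -
  have "decseq u"
  proof (rule decseq_SucI)
    show "u (Suc n) \<le> u n" for n
      using step[of n] mult_nonneg_nonneg[OF w(1) u, of n n] by linarith
  qed
  moreover have "\<forall>i. 0 \<le> u i"
    using u by blast
  ultimately obtain L where L: "u \<longlonglongrightarrow> L" "\<forall>i. L \<le> u i"
    by (rule decseq_convergent)
  have "L \<ge> 0"
    using LIMSEQ_le_const[OF L(1), of 0] u by blast
  have *: "L * sum w {..<n} \<le> u 0 - u n" for n
  proof (induction n)
    case (Suc n)
    have "L * w n \<le> w n * u n"
      using mult_left_mono[OF spec[OF L(2), of n] w(1)[of n]] by (simp add: mult.commute)
    then show ?case
      using Suc step[of n] by (simp add: distrib_left)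
  qed simp
  have "L = 0"
  proof (rule ccontr)
    assume "L \<noteq> 0"
    with \<open>L \<ge> 0\<close> have "L > 0"
      by simp
    have "sum w {..<n} \<le> u 0 / L" for n
      using *[of n] u[of n] \<open>L > 0\<close> by (simp add: field_simps)
    then show False
      using w summableI_nonneg_bounded by blast
  qed
  with L(1) show ?thesis
    by simp
qed

section \<open>Selfadjoint operators and the choice of one diagonal entry\<close>

lemma bounded_opD:
  assumes "bounded_op T"
  shows "T (x + y) = T x + T y" "T (x - y) = T x - T y" "T (r *\<^sub>R x) = r *\<^sub>R T x"
    "T (c *\<^sub>C x) = c *\<^sub>C T x" "T 0 = 0" "T (- x) = - T x"
proof -
  interpret bounded_linear T
    using assms by (simp add: bounded_op_def)
  show "T (x + y) = T x + T y" "T (x - y) = T x - T y" "T (r *\<^sub>R x) = r *\<^sub>R T x"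
    "T (c *\<^sub>C x) = c *\<^sub>C T x" "T 0 = 0" "T (- x) = - T x"
    using assms by (simp_all add: add diff scaleR zero neg bounded_op_def)
qed

lemma selfadjointD: "selfadjoint T \<Longrightarrow> cinner (T x) y = cinner x (T y)"
  by (simp add: selfadjoint_def)

lemma selfadjoint_cinner_real:
  assumes "selfadjoint T"
  shows "cinner (T x) x = complex_of_real (inner (T x) x)"
proof -
  have "cinner (T x) x = cnj (cinner (T x) x)"
    using assms by (metis cinner_commute selfadjointD)
  then have "Im (cinner (T x) x) = 0"
    by (metis add.inverse_inverse cnj.sel(2) equal_neg_zero)
  then show ?thesis
    by (simp add: complex_eq_iff Re_cinner)
qed

text \<open>Orthogonality of \<open>w\<close> to \<open>T u\<close>, with selfadjointness, kills
  both cross terms. The quadratic form is thus affine in the weight \<open>l\<close>, and a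
  prescribed value amounts to a linear equation for \<open>l\<close>.\<close>

lemma combine_orthogonal:
  fixes u w :: "'a::complex_hilbert"
  assumes T: "bounded_op T" "selfadjoint T" and u: "norm u = 1" and w: "norm w = 1"
    and orth: "cinner w u = 0" "cinner w (T u) = 0" and l: "0 \<le> l" "l \<le> 1"
  defines "v \<equiv> sqrt l *\<^sub>R u + sqrt (1 - l) *\<^sub>R w"
  shows "norm v = 1"
    and "inner (T v) v = l * inner (T u) u + (1 - l) * inner (T w) w"
    and "cinner u v = complex_of_real (sqrt l)"
proof -
  have uw: "cinner u w = 0"
    using orth(1) by (simp add: cinner_eq_0_commute)
  have "(norm v)\<^sup>2 = l + (1 - l)"
    unfolding v_def using l u w
    by (subst pythagoras) (auto simp: cinner_scaleR_left cinner_scaleR_right uw power_mult_distrib)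
  then show "norm v = 1"
    using norm_ge_zero[of v] by (auto simp: power2_eq_1_iff)
  have "cinner (T u) w = 0"
    using orth(2) by (simp add: cinner_eq_0_commute)
  moreover have "cinner (T w) u = 0"
    using orth(2) T(2) by (simp add: selfadjointD)
  ultimately have "inner (T u) w = 0" "inner (T w) u = 0"
    by (simp_all flip: Re_cinner)
  then have "inner (T v) v = (sqrt l * sqrt l) * inner (T u) u +
      (sqrt (1 - l) * sqrt (1 - l)) * inner (T w) w"
    unfolding v_def by (simp add: bounded_opD[OF T(1)] inner_simps algebra_simps)
  then show "inner (T v) v = l * inner (T u) u + (1 - l) * inner (T w) w"
    using l by simp
  show "cinner u v = complex_of_real (sqrt l)"
    using u uw by (simp add: v_def cinner_add_right cinner_scaleR_right norm_eq_1_cinner)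
qed

text \<open>A single step of the basis construction: \<open>G\<close> holds the vectors to avoid,
  \<open>r\<close> is the residual of the current target, and the last inequality is the guaranteed
  gain on that target.\<close>

lemma unit_vector_with_value:
  fixes r :: "'a::complex_hilbert"
  assumes T: "bounded_op T" "selfadjoint T"
    and range: "\<And>x. norm x = 1 \<Longrightarrow> a \<le> inner (T x) x \<and> inner (T x) x \<le> b"
    and attains: "\<And>N s. finite N \<Longrightarrow> a < s \<Longrightarrow> s < b \<Longrightarrow>
      \<exists>v. norm v = 1 \<and> (\<forall>g\<in>N \<union> G. cinner v g = 0) \<and> inner (T v) v = s"
    and d: "a < d" "d < b" and r: "\<And>g. g \<in> G \<Longrightarrow> cinner r g = 0"
  shows "\<exists>v. norm v = 1 \<and> (\<forall>g\<in>G. cinner v g = 0) \<and> inner (T v) v = d \<and>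
    min (d - a) (b - d) / (2 * (b - a)) * (norm r)\<^sup>2 \<le> (cmod (cinner r v))\<^sup>2"
proof (cases "r = 0")
  case True
  then show ?thesis
    using attains[of "{}" d] d by auto
next
  case False
  define u where "u = (1 / norm r) *\<^sub>R r"
  define t where "t = inner (T u) u"
  have u: "norm u = 1" "r = norm r *\<^sub>R u"
    using False by (simp_all add: u_def)
  have t: "a \<le> t" "t \<le> b"
    using range[OF u(1)] by (simp_all add: t_def)
  have uG: "cinner u g = 0" if "g \<in> G" for g
    using r[OF that] by (simp add: u_def cinner_scaleR_left)
  \<comment> \<open>A lower bound for the weight \<open>l\<close> suffices: the overlap
    \<open>sqrt l\<close> with \<open>u\<close> captures the fraction \<open>l\<close> of the
    squared norm of \<open>r\<close>.\<close>
  have goal: ?thesis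
    if v: "norm v = 1" "\<And>g. g \<in> G \<Longrightarrow> cinner v g = 0" "inner (T v) v = d"
      "cinner u v = complex_of_real (sqrt l)" "min (d - a) (b - d) / (2 * (b - a)) \<le> l" for v l
  proof -
    have "0 < min (d - a) (b - d) / (2 * (b - a))"
      using d by simp
    then have "l > 0"
      using v(5) by linarith
    have "cmod (cinner r v) = norm r * sqrt l"
      using \<open>l > 0\<close> by (subst u(2)) (simp add: cinner_scaleR_left v(4) norm_mult)
    then have "(cmod (cinner r v))\<^sup>2 = l * (norm r)\<^sup>2"
      using \<open>l > 0\<close> by (simp add: power_mult_distrib)
    then show ?thesis
      using v mult_right_mono[OF v(5), of "(norm r)\<^sup>2"] by auto
  qed
  show ?thesis
  proof (cases "t = d")
    case True
    have "min (d - a) (b - d) / (2 * (b - a)) \<le> 1"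
      using d by (subst divide_le_eq_1_pos) auto
    then show ?thesis
      using goal[of u 1] u(1) uG True by (simp add: t_def norm_eq_1_cinner)
  next
    case False
    \<comment> \<open>The auxiliary value lies on the other side of \<open>d\<close> from
      \<open>t\<close>, halfway to the endpoint there. So \<open>s\<close> has distance at least
      half the minimum from \<open>d\<close> and at most \<open>b - a\<close> from \<open>t\<close>,
      which bounds the weight \<open>l\<close> solving \<open>l * t + (1 - l) * s = d\<close> from
      below.\<close>
    define s where "s = (if t < d then (b + d) / 2 else (a + d) / 2)"
    define l where "l = (s - d) / (s - t)"
    have s: "a < s" "s < b"
      using d by (auto simp: s_def)
    have "s \<noteq> t"
      using False d by (auto simp: s_def)
    have "l * (s - t) = s - d"
      using \<open>s \<noteq> t\<close> by (simp add: l_def)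
    then have l: "l * t + (1 - l) * s = d"
      by (simp add: algebra_simps)
    have l01: "0 \<le> l" "l \<le> 1"
    proof -
      consider "t < d" "d < s" | "s < d" "d < t"
        using False d by (cases "t < d") (auto simp: s_def)
      then show "0 \<le> l" "l \<le> 1"
        by (cases; simp add: l_def divide_le_eq_1 zero_le_divide_iff)+
    qed
    have "min (d - a) (b - d) / (2 * (b - a)) \<le> l"
    proof (cases "t < d")
      case True
      have "min (d - a) (b - d) / (2 * (b - a)) \<le> ((b - d) / 2) / (b - a)"
        unfolding divide_divide_eq_left using d by (intro divide_right_mono) auto
      also have "\<dots> \<le> ((b - d) / 2) / (s - t)"
      proof (intro divide_left_mono mult_pos_pos)
        have "t < s"
          using d True by (simp add: s_def)
        then show "s - t \<le> b - a" "0 < s - t"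
          using s t by simp_all
      qed (use d in auto)
      also have "\<dots> = l"
        using True by (simp add: l_def s_def diff_divide_distrib add_divide_distrib)
      finally show ?thesis .
    next
      case False
      with \<open>t \<noteq> d\<close> have "d < t"
        by simp
      have "min (d - a) (b - d) / (2 * (b - a)) \<le> ((d - a) / 2) / (b - a)"
        unfolding divide_divide_eq_left using d by (intro divide_right_mono) auto
      also have "\<dots> \<le> ((d - a) / 2) / (t - s)"
      proof (intro divide_left_mono mult_pos_pos)
        have "s < t"
          using d \<open>d < t\<close> by (simp add: s_def)
        then show "t - s \<le> b - a" "0 < t - s"
          using s t by simp_all
      qed (use d in auto)
      also have "\<dots> = (d - s) / (t - s)"
        using False by (simp add: s_def diff_divide_distrib add_divide_distrib)
      also have "\<dots> = l"
        using minus_divide_divide[of "d - s" "t - s"] by (simp add: l_def)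
      finally show ?thesis .
    qed
    \<comment> \<open>\<open>T u\<close> joins the finite set so that the cross terms between
      \<open>u\<close> and \<open>w\<close> vanish.\<close>
    moreover obtain w where w: "norm w = 1" "\<And>g. g \<in> {u, T u} \<union> G \<Longrightarrow> cinner w g = 0"
      "inner (T w) w = s"
      using attains[of "{u, T u}" s] s by blast
    note comb = combine_orthogonal[OF T u(1) w(1) w(2)[of u] w(2)[of "T u"] l01]
    ultimately show ?thesis
      using comb w uG l
      by (intro goal[of "sqrt l *\<^sub>R u + sqrt (1 - l) *\<^sub>R w" l])
        (auto simp: cinner_add_left cinner_scaleR_left t_def)
  qed
qed

section \<open>Recursive construction of the basis\<close>

text \<open>Indices outside \<open>I\<close> keep the given vectors \<open>f\<close>; the others are
  filled recursively. Since there may be infinitely many vectors \<open>f\<close>,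
  \<open>attains\<close> asks for orthogonality to all of them besides a finite set.\<close>

theorem orthonormal_basis_with_diagonal:
  fixes T :: "'a::complex_hilbert \<Rightarrow> 'a" and f :: "nat \<Rightarrow> 'a" and d :: "nat \<Rightarrow> real"
  assumes sep: "separable_space (euclidean :: 'a topology)"
    and T: "bounded_op T" "selfadjoint T"
    and range: "\<And>x. norm x = 1 \<Longrightarrow> a \<le> inner (T x) x \<and> inner (T x) x \<le> b"
    and f: "\<And>i j. i \<notin> I \<Longrightarrow> j \<notin> I \<Longrightarrow> cinner (f i) (f j) = (if i = j then 1 else 0)"
    and attains: "\<And>N s. finite N \<Longrightarrow> a < s \<Longrightarrow> s < b \<Longrightarrow>
      \<exists>v. norm v = 1 \<and> (\<forall>g\<in>N \<union> f ` (- I). cinner v g = 0) \<and> inner (T v) v = s"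
    and d: "\<And>k. k \<in> I \<Longrightarrow> a < d k \<and> d k < b"
    and div: "\<not> summable (\<lambda>k. if k \<in> I then min (d k - a) (b - d k) else 0)"
  shows "\<exists>e. orthonormal_basis e \<and> (\<forall>k\<in>I. inner (T (e k)) (e k) = d k) \<and>
    (\<forall>k. k \<notin> I \<longrightarrow> e k = f k)"
proof -
  have "\<exists>k. k \<in> I"
  proof (rule ccontr)
    assume "\<nexists>k. k \<in> I"
    then have "(\<lambda>k. if k \<in> I then min (d k - a) (b - d k) else 0) = (\<lambda>k. 0)"
      by auto
    then show False
      using div by simp
  qed
  then have "a < b"
    using d by (metis order.strict_trans)
  obtain C :: "'a set" where C: "countable C" "closure C = UNIV"
    using sep unfolding separable_space_def by auto
  then have "C \<noteq> {}"
    by auto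
  define y where "y = from_nat_into C"
  have y: "closure (range y) = UNIV"
    unfolding y_def range_from_nat_into[OF \<open>C \<noteq> {}\<close> C(1)] by (rule C(2))
  define F where "F = f ` (- I)"
  \<comment> \<open>The recursion subtracts only vectors chosen so far, whereas \<open>F\<close> may
    be infinite. The targets are therefore made orthogonal to all of \<open>F\<close> beforehand;
    the removed part lies in the closed span of \<open>F\<close>, which the basis will
    contain.\<close>
  have "\<exists>z. y i - z \<in> closure (cspan F) \<and> (\<forall>g\<in>F. cinner z g = 0)" for i
  proof -
    obtain p where "p \<in> closure (cspan F)" "\<And>k. k \<in> - I \<Longrightarrow> cinner (y i - p) (f k) = 0"
      using closed_span_projection[of "- I" f "y i"] f unfolding F_def by auto
    then show ?thesis
      by (intro exI[of _ "y i - p"]) (auto simp: F_def)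
  qed
  then obtain z where z: "\<And>i. y i - z i \<in> closure (cspan F)" "\<And>i g. g \<in> F \<Longrightarrow> cinner (z i) g = 0"
    by metis
  \<comment> \<open>The fraction of the squared residual that step \<open>k\<close> is sure to
    remove from the target it serves; zero at the prescribed vectors.\<close>
  define w where "w k = (if k \<in> I then min (d k - a) (b - d k) else 0) / (2 * (b - a))" for k
  have w0: "0 \<le> w k" for k
    using d[of k] \<open>a < b\<close> by (auto simp: w_def)
  have w1: "w k \<le> 1" for k
  proof -
    have "(if k \<in> I then min (d k - a) (b - d k) else 0) \<le> 2 * (b - a)"
      using d[of k] \<open>a < b\<close> by auto
    then show ?thesis
      unfolding w_def using \<open>a < b\<close> by (subst divide_le_eq_1_pos) auto
  qed
  have "\<not> summable w"
  proof
    assume "summable w"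
    then have "summable (\<lambda>k. w k * (2 * (b - a)))"
      by (rule summable_mult2)
    then show False
      using div \<open>a < b\<close> by (simp add: w_def)
  qed
  \<comment> \<open>\<open>t n\<close> is the target served at step \<open>n\<close>; each target
    receives a divergent share of \<open>w\<close>.\<close>
  obtain t :: "nat \<Rightarrow> nat" where t: "\<And>i. \<not> summable (\<lambda>n. if t n = i then w n else 0)"
    by (rule divergent_partition[OF w0 w1 \<open>\<not> summable w\<close>]) blast
  define r where "r e n = z (t n) - partial_expansion (z (t n)) e n" for e :: "nat \<Rightarrow> 'a" and n
  \<comment> \<open>Specification of the \<open>n\<close>-th vector. It consults \<open>e\<close>
    only below \<open>n\<close>, as the recursion principle requires, because \<open>r e n\<close>
    involves only the first \<open>n\<close> vectors.\<close>
  define P where "P e n v \<longleftrightarrow> (if n \<in> I then norm v = 1 \<and> (\<forall>k<n. cinner v (e k) = 0) \<and>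
      (\<forall>g\<in>F. cinner v g = 0) \<and> inner (T v) v = d n \<and>
      w n * (norm (r e n))\<^sup>2 \<le> (cmod (cinner (r e n) v))\<^sup>2 else v = f n)" for e n v
  have orth: "cinner (e i) (e k) = (if i = k then 1 else 0)"
    if P: "\<And>k. k < n \<Longrightarrow> P e k (e k)" and "i < n" "k < n" for e n i k
  proof -
    have less: "cinner (e k) (e i) = 0" if "i < k" "k < n" for i k
    proof (cases "k \<in> I")
      case True
      then show ?thesis
        using P[OF that(2)] that(1) by (simp add: P_def)
    next
      case False
      then have k: "e k = f k"
        using P[OF that(2)] by (simp add: P_def)
      show ?thesis
      proof (cases "i \<in> I")
        case True
        then have "cinner (e i) (f k) = 0"
          using P[of i] that False by (auto simp: P_def F_def)
        then show ?thesis
          unfolding k by (simp add: cinner_eq_0_commute)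
      next
        case i: False
        then have "e i = f i"
          using P[of i] that by (simp add: P_def)
        then show ?thesis
          unfolding k using f[OF False i] that by simp
      qed
    qed
    have "cinner (e k) (e k) = 1"
      using P[OF that(3)] f[of k k] by (cases "k \<in> I") (simp_all add: P_def norm_eq_1_cinner)
    moreover have "cinner (e i) (e k) = 0" if "i \<noteq> k"
    proof (cases "i < k")
      case True
      show ?thesis
        by (subst cinner_eq_0_commute) (rule less[OF True \<open>k < n\<close>])
    next
      case False
      with that show ?thesis
        by (intro less \<open>i < n\<close>) simp
    qed
    ultimately show ?thesis
      by auto
  qed
  have "\<exists>e. \<forall>n. P e n (e n)"
  proof (rule dependent_wellorder_choice)
    show "P e n v = P e' n v" if "\<And>k. k < n \<Longrightarrow> e k = e' k" for v e e' n
    proof -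
      have "r e n = r e' n"
        unfolding r_def using partial_expansion_cong[of n e e'] that by simp
      then show ?thesis
        unfolding P_def using that by auto
    qed
  next
    fix n e assume P: "\<And>k. k < n \<Longrightarrow> P e k (e k)"
    show "\<exists>v. P e n v"
    proof (cases "n \<in> I")
      case True
      have "orthonormal_upto e n"
        using orth[OF P] by (auto simp: orthonormal_upto_def norm_eq_1_cinner)
      then have re: "cinner (r e n) (e k) = 0" if "k < n" for k
        unfolding r_def using that by (rule partial_expansion_residual_orthogonal)
      \<comment> \<open>Each term of the expansion is harmless: for \<open>k \<in> I\<close> the
        vector \<open>e k\<close> is orthogonal to \<open>F\<close>, and otherwise
        \<open>e k\<close> lies in \<open>F\<close> and has coefficient zero.\<close>
      have rF: "cinner (r e n) g = 0" if "g \<in> F" for g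
      proof -
        have "cinner (z (t n)) (e k) * cinner (e k) g = 0" if "k < n" for k
          using P[OF that] \<open>g \<in> F\<close> z(2) by (cases "k \<in> I") (auto simp: P_def F_def)
        then show ?thesis
          using z(2)[OF that]
          unfolding r_def partial_expansion_def cinner_diff_left cinner_sum_left cinner_scaleC_left
          by (subst sum.neutral) auto
      qed
      have "\<exists>v. norm v = 1 \<and> (\<forall>g\<in>N \<union> (e ` {..<n} \<union> F). cinner v g = 0) \<and> inner (T v) v = s"
        if "finite N" "a < s" "s < b" for N s
        using attains[of "N \<union> e ` {..<n}" s] that by (simp add: F_def Un_assoc)
      note step = unit_vector_with_value[OF T range this]
      have "\<exists>v. norm v = 1 \<and> (\<forall>g\<in>e ` {..<n} \<union> F. cinner v g = 0) \<and> inner (T v) v = d n \<and>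
          min (d n - a) (b - d n) / (2 * (b - a)) * (norm (r e n))\<^sup>2 \<le> (cmod (cinner (r e n) v))\<^sup>2"
        by (rule step) (use d[OF True] re rF in auto)
      then obtain v where v: "norm v = 1" "\<forall>g\<in>e ` {..<n} \<union> F. cinner v g = 0" "inner (T v) v = d n"
        "min (d n - a) (b - d n) / (2 * (b - a)) * (norm (r e n))\<^sup>2 \<le> (cmod (cinner (r e n) v))\<^sup>2"
        by blast
      have "P e n v"
        unfolding P_def w_def using True v by simp
      then show ?thesis
        by blast
    qed (simp add: P_def)
  qed
  then obtain e where P: "\<And>n. P e n (e n)"
    by blast
  have e_orth: "cinner (e i) (e k) = (if i = k then 1 else 0)" for i k
    using orth[of "Suc (max i k)" e i k] P by simp
  then have upto: "orthonormal_upto e n" for n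
    by (simp add: orthonormal_upto_def norm_eq_1_cinner)
  have "e k = f k" if "k \<notin> I" for k
    using P[of k] that by (simp add: P_def)
  then have F: "F \<subseteq> range e"
    unfolding F_def by (metis ComplD image_subsetI rangeI)
  have "z i \<in> closure (cspan (range e))" for i
  proof -
    \<comment> \<open>Squared distance of target \<open>i\<close> to the span of the first
      \<open>n\<close> vectors: it shrinks by the factor \<open>1 - w n\<close> when
      \<open>i\<close> is served and never grows.\<close>
    define u where "u n = (norm (z i - partial_expansion (z i) e n))\<^sup>2" for n
    have "u \<longlonglongrightarrow> 0"
    proof (rule damped_sequence_tendsto_zero)
      show "\<not> summable (\<lambda>n. if t n = i then w n else 0)"
        by (rule t)
      show "u (Suc n) \<le> u n - (if t n = i then w n else 0) * u n" for n
      proof -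
        have u: "u (Suc n) = u n - (cmod (cinner (z i - partial_expansion (z i) e n) (e n)))\<^sup>2"
          unfolding u_def by (rule partial_expansion_residual_Suc[OF upto])
        show ?thesis
        proof (cases "t n = i \<and> n \<in> I")
          case True
          then have "w n * u n \<le> (cmod (cinner (z i - partial_expansion (z i) e n) (e n)))\<^sup>2"
            using P[of n] by (simp add: P_def r_def u_def)
          with True u show ?thesis
            by simp
        next
          case False
          then have "(if t n = i then w n else 0) = 0"
            by (auto simp: w_def)
          then show ?thesis
            unfolding u by simp
        qed
      qed
    qed (auto simp: u_def w0)
    then have "(\<lambda>n. sqrt (u n)) \<longlonglongrightarrow> sqrt 0"
      by (rule tendsto_real_sqrt)
    then have "(\<lambda>n. z i - partial_expansion (z i) e n) \<longlonglongrightarrow> 0"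
      by (subst tendsto_norm_zero_iff[symmetric]) (simp add: u_def)
    from tendsto_diff[OF tendsto_const[of "z i"] this]
    have "partial_expansion (z i) e \<longlonglongrightarrow> z i"
      by simp
    moreover have "partial_expansion (z i) e n \<in> cspan (range e)" for n
      using partial_expansion_in_cspan[of "z i" e n]
        complex_vector.span_mono[of "e ` {..<n}" "range e"] by blast
    ultimately show ?thesis
      unfolding closure_sequential by blast
  qed
  moreover have "y i - z i \<in> closure (cspan (range e))" for i
    using z(1) closure_mono[OF complex_vector.span_mono[OF F]] by blast
  ultimately have "z i + (y i - z i) \<in> closure (cspan (range e))" for i
    by (rule closure_cspan_add)
  then have "range y \<subseteq> closure (cspan (range e))"
    by auto
  then have "closure (cspan (range e)) = UNIV"
    using y closure_minimal[OF _ closed_closure] by blast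
  then have "orthonormal_basis e"
    using e_orth by (simp add: orthonormal_basis_def)
  then show ?thesis
    using P by (intro exI[of _ e]) (simp add: P_def)
qed

section \<open>Essential spectrum\<close>

text \<open>An inverse in the quotient is the coset of a parametrix \<open>R\<close>, and two cosets
  agree exactly when their representatives differ by a compact operator. All later arguments on the
  essential spectrum use parametrices.\<close>

lemma calkin_unit_iff:
  fixes S :: "'a::complex_hilbert \<Rightarrow> 'a"
  assumes S: "bounded_op S"
  shows "compact_ops +>\<^bsub>op_ring\<^esub> S \<in> Units calkin \<longleftrightarrow>
    (\<exists>R. bounded_op R \<and> (\<lambda>x. R (S x) - x) \<in> compact_ops \<and> (\<lambda>x. S (R x) - x) \<in> compact_ops)"
proof -
  interpret I: ideal compact_ops "op_ring :: ('a \<Rightarrow> 'a) ring"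
    by (rule ideal_compact_ops)
  have carrier: "f \<in> carrier op_ring \<longleftrightarrow> bounded_op f" for f :: "'a \<Rightarrow> 'a"
    by (simp add: op_ring_def)
  have carrier_calkin: "carrier (calkin :: ('a \<Rightarrow> 'a) set ring) =
      {compact_ops +>\<^bsub>op_ring\<^esub> R | R. bounded_op R}"
    by (auto simp: calkin_def FactRing_def A_RCOSETS_def' carrier)
  have mult: "(compact_ops +>\<^bsub>op_ring\<^esub> P) \<otimes>\<^bsub>calkin\<^esub> (compact_ops +>\<^bsub>op_ring\<^esub> Q) =
      compact_ops +>\<^bsub>op_ring\<^esub> (P \<circ> Q)" if "bounded_op P" "bounded_op Q" for P Q :: "'a \<Rightarrow> 'a"
    using I.rcoset_mult_add[of P Q] that unfolding carrier
    by (simp add: calkin_def FactRing_def) (simp add: op_ring_def)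
  have one: "\<one>\<^bsub>calkin\<^esub> = compact_ops +>\<^bsub>op_ring\<^esub> (id :: 'a \<Rightarrow> 'a)"
    by (simp add: calkin_def FactRing_def) (simp add: op_ring_def)
  have eq: "compact_ops +>\<^bsub>op_ring\<^esub> P = compact_ops +>\<^bsub>op_ring\<^esub> id \<longleftrightarrow> (\<lambda>x. P x - x) \<in> compact_ops"
    if "bounded_op P" for P :: "'a \<Rightarrow> 'a"
  proof -
    have "P \<ominus>\<^bsub>op_ring\<^esub> id = (\<lambda>x. P x - x)"
      unfolding a_minus_def op_ring_a_inv[OF bounded_op_id] by (simp add: op_ring_def)
    then show ?thesis
      using I.quotient_eq_iff_same_a_r_cos[OF ideal_compact_ops, of P id] that bounded_op_id[where ?'a = 'a]
      by (simp add: carrier)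
  qed
  show ?thesis
  proof
    assume "compact_ops +>\<^bsub>op_ring\<^esub> S \<in> Units calkin"
    then obtain R where R: "bounded_op R"
      "(compact_ops +>\<^bsub>op_ring\<^esub> R) \<otimes>\<^bsub>calkin\<^esub> (compact_ops +>\<^bsub>op_ring\<^esub> S) = \<one>\<^bsub>calkin\<^esub>"
      "(compact_ops +>\<^bsub>op_ring\<^esub> S) \<otimes>\<^bsub>calkin\<^esub> (compact_ops +>\<^bsub>op_ring\<^esub> R) = \<one>\<^bsub>calkin\<^esub>"
      unfolding Units_def carrier_calkin by blast
    show "\<exists>R. bounded_op R \<and> (\<lambda>x. R (S x) - x) \<in> compact_ops \<and> (\<lambda>x. S (R x) - x) \<in> compact_ops"
      using R eq[OF bounded_op_comp[OF R(1) S]] eq[OF bounded_op_comp[OF S R(1)]]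
      by (intro exI[of _ R]) (simp add: mult S one)
  next
    assume "\<exists>R. bounded_op R \<and> (\<lambda>x. R (S x) - x) \<in> compact_ops \<and> (\<lambda>x. S (R x) - x) \<in> compact_ops"
    then obtain R where R: "bounded_op R" "(\<lambda>x. R (S x) - x) \<in> compact_ops"
      "(\<lambda>x. S (R x) - x) \<in> compact_ops"
      by blast
    have "(compact_ops +>\<^bsub>op_ring\<^esub> R) \<otimes>\<^bsub>calkin\<^esub> (compact_ops +>\<^bsub>op_ring\<^esub> S) = \<one>\<^bsub>calkin\<^esub>"
      "(compact_ops +>\<^bsub>op_ring\<^esub> S) \<otimes>\<^bsub>calkin\<^esub> (compact_ops +>\<^bsub>op_ring\<^esub> R) = \<one>\<^bsub>calkin\<^esub>"
      using R eq[OF bounded_op_comp[OF R(1) S]] eq[OF bounded_op_comp[OF S R(1)]]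
      by (simp_all add: mult S one)
    then show "compact_ops +>\<^bsub>op_ring\<^esub> S \<in> Units calkin"
      using S R(1) unfolding Units_def carrier_calkin by blast
  qed
qed

lemma ess_spectrum_iff:
  assumes "bounded_op T"
  shows "l \<in> ess_spectrum T \<longleftrightarrow> (\<nexists>R. bounded_op R \<and>
    (\<lambda>x. R (T x - l *\<^sub>C x) - x) \<in> compact_ops \<and> (\<lambda>x. (T (R x) - l *\<^sub>C R x) - x) \<in> compact_ops)"
  unfolding ess_spectrum_def mem_Collect_eq calkin_unit_iff[OF bounded_op_shift[OF assms]] ..

section \<open>Positive and coercive operators\<close>

lemma selfadjoint_shift:
  assumes "selfadjoint T"
  shows "selfadjoint (\<lambda>x. T x - complex_of_real c *\<^sub>C x)"
  unfolding selfadjoint_def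
  by (simp add: cinner_simps selfadjointD[OF assms])

lemma selfadjoint_inner: "selfadjoint S \<Longrightarrow> inner (S x) y = inner x (S y)"
  by (simp add: selfadjointD flip: Re_cinner)

lemma selfadjoint_uminus:
  assumes "selfadjoint T"
  shows "selfadjoint (\<lambda>x. - T x)"
  unfolding selfadjoint_def
  by (simp add: cinner_simps selfadjointD[OF assms])

text \<open>The form is nonnegative at \<open>x - t *\<^sub>R S x\<close>; expanding there with
  \<open>t = 1 / M\<close> gives the bound. A unit vector with small value of the form is therefore
  almost annihilated by \<open>S\<close>.\<close>

lemma positive_op_norm_le:
  fixes S :: "'a::complex_hilbert \<Rightarrow> 'a"
  assumes S: "bounded_op S" "selfadjoint S" and "M > 0"
    and pos: "\<And>x. 0 \<le> inner (S x) x" and le: "\<And>x. inner (S x) x \<le> M * (norm x)\<^sup>2"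
  shows "(norm (S x))\<^sup>2 \<le> M * inner (S x) x"
proof -
  define t where "t = 1 / M"
  have "inner (S (x - t *\<^sub>R S x)) (x - t *\<^sub>R S x) =
      inner (S x) x - 2 * t * (norm (S x))\<^sup>2 + t\<^sup>2 * inner (S (S x)) (S x)"
    using selfadjoint_inner[OF S(2), of "S x" x]
    by (simp add: bounded_opD[OF S(1)] inner_simps power2_norm_eq_inner power2_eq_square[of t] algebra_simps)
  moreover have "t\<^sup>2 * inner (S (S x)) (S x) \<le> t\<^sup>2 * (M * (norm (S x))\<^sup>2)"
    by (intro mult_left_mono le) simp
  moreover have "t\<^sup>2 * (M * (norm (S x))\<^sup>2) = t * (norm (S x))\<^sup>2"
    using \<open>M > 0\<close> by (simp add: t_def power2_eq_square)
  ultimately have "0 \<le> inner (S x) x - t * (norm (S x))\<^sup>2"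
    using pos[of "x - t *\<^sub>R S x"] by linarith
  then have "t * (norm (S x))\<^sup>2 \<le> inner (S x) x"
    by linarith
  then show ?thesis
    using \<open>M > 0\<close> by (simp add: t_def pos_divide_le_eq mult.commute)
qed

text \<open>Lax-Milgram by Banach's fixed point theorem: \<open>S x = y\<close> says that
  \<open>x\<close> is fixed by the map \<open>x - t *\<^sub>R (S x - y)\<close>, a contraction for
  suitable \<open>t\<close>. Coercivity also bounds the inverse.\<close>

lemma coercive_op_invertible:
  fixes S :: "'a::complex_hilbert \<Rightarrow> 'a"
  assumes S: "bounded_op S" and "c > 0" and coercive: "\<And>x. c * (norm x)\<^sup>2 \<le> inner (S x) x"
  shows "\<exists>R. bounded_op R \<and> (\<forall>x. R (S x) = x) \<and> (\<forall>x. S (R x) = x)"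
proof -
  have "bounded_linear S"
    using S by (simp add: bounded_op_def)
  then obtain C0 where C0: "\<And>x. norm (S x) \<le> norm x * C0"
    using bounded_linear.pos_bounded by blast
  \<comment> \<open>The maximum ensures \<open>c \<le> C\<close>, so the radicand in
    \<open>q\<close> is nonnegative.\<close>
  define C where "C = max C0 c"
  have "C > 0" "c \<le> C"
    using \<open>c > 0\<close> by (auto simp: C_def)
  have C: "norm (S x) \<le> C * norm x" for x
    using C0[of x] mult_left_mono[of C0 C "norm x"] by (simp add: C_def mult.commute)
  \<comment> \<open>This \<open>t\<close> minimises
    \<open>1 - 2 * t * c + t\<^sup>2 * C\<^sup>2\<close>, and the minimum is the square of
    \<open>q\<close>.\<close>
  define t where "t = c / C\<^sup>2"
  define q where "q = sqrt (1 - (c / C)\<^sup>2)"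
  have "(c / C)\<^sup>2 \<le> 1" "(c / C)\<^sup>2 > 0"
    using \<open>c > 0\<close> \<open>c \<le> C\<close> \<open>C > 0\<close> by (simp_all add: power_le_one)
  then have q: "0 \<le> q" "q < 1" "q\<^sup>2 = 1 - (c / C)\<^sup>2"
    by (simp_all add: q_def)
  have contr: "norm (x - t *\<^sub>R S x) \<le> q * norm x" for x
  proof (rule power2_le_imp_le)
    have "t > 0"
      using \<open>c > 0\<close> \<open>C > 0\<close> by (simp add: t_def)
    have "(norm (x - t *\<^sub>R S x))\<^sup>2 = (norm x)\<^sup>2 - 2 * t * inner (S x) x + t\<^sup>2 * (norm (S x))\<^sup>2"
      by (simp add: inner_simps power2_norm_eq_inner power2_eq_square[of t] inner_commute algebra_simps)
    also have "\<dots> \<le> (norm x)\<^sup>2 - 2 * t * (c * (norm x)\<^sup>2) + t\<^sup>2 * (C * norm x)\<^sup>2"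
    proof -
      have "2 * t * (c * (norm x)\<^sup>2) \<le> 2 * t * inner (S x) x"
        using \<open>t > 0\<close> by (intro mult_left_mono coercive) simp
      moreover have "t\<^sup>2 * (norm (S x))\<^sup>2 \<le> t\<^sup>2 * (C * norm x)\<^sup>2"
        by (intro mult_left_mono power_mono C) simp_all
      ultimately show ?thesis
        by linarith
    qed
    also have "\<dots> = (q * norm x)\<^sup>2"
      using \<open>C > 0\<close> unfolding power_mult_distrib q(3) t_def
      by (simp add: field_simps power2_eq_square)
    finally show "(norm (x - t *\<^sub>R S x))\<^sup>2 \<le> (q * norm x)\<^sup>2" .
  qed (simp add: q)
  have "t \<noteq> 0"
    using \<open>c > 0\<close> \<open>C > 0\<close> by (simp add: t_def)
  have "\<exists>!x. S x = y" for y
  proof -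
    define g where "g x = x - t *\<^sub>R (S x - y)" for x
    have "dist (g x) (g x') \<le> q * dist x x'" for x x'
    proof -
      have "g x - g x' = (x - x') - t *\<^sub>R S (x - x')"
        by (simp add: g_def bounded_opD[OF S] algebra_simps)
      then show ?thesis
        using contr[of "x - x'"] by (simp add: dist_norm)
    qed
    then have "\<exists>!x. g x = x"
      using banach_fix_type[OF q(1,2), of g] by blast
    moreover have "g x = x \<longleftrightarrow> S x = y" for x
      using \<open>t \<noteq> 0\<close> by (simp add: g_def)
    ultimately show ?thesis
      by simp
  qed
  then obtain R where R: "\<And>y. S (R y) = y" "\<And>x y. S x = y \<Longrightarrow> x = R y"
    by metis
  have "norm (R y) \<le> norm y * (1 / c)" for y
  proof -
    have "c * (norm (R y))\<^sup>2 \<le> norm y * norm (R y)"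
      using coercive[of "R y"] norm_cauchy_schwarz[of y "R y"] by (simp add: R(1))
    then have "c * norm (R y) \<le> norm y"
      by (cases "R y = 0") (simp_all add: power2_eq_square flip: mult.assoc)
    then show ?thesis
      using \<open>c > 0\<close> by (simp add: pos_le_divide_eq mult.commute)
  qed
  moreover have "R (x + y) = R x + R y" "R (r *\<^sub>R x) = r *\<^sub>R R x" "R (a *\<^sub>C x) = a *\<^sub>C R x" for x y r a
    by (rule R(2)[symmetric]; simp add: bounded_opD[OF S] R(1))+
  ultimately have "bounded_op R"
    unfolding bounded_op_def by (auto intro!: bounded_linear_intro[of R "1 / c"])
  moreover have "R (S x) = x" for x
    using R(2)[of x "S x"] by simp
  ultimately show ?thesis
    using R(1) by blast
qed

lemma not_ess_spectrum_invertible: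
  assumes T: "bounded_op T" and R: "bounded_op R" "\<And>x. R (T x - l *\<^sub>C x) = x"
    "\<And>x. T (R x) - l *\<^sub>C R x = x"
  shows "l \<notin> ess_spectrum T"
proof -
  have "\<exists>R. bounded_op R \<and> (\<lambda>x. R (T x - l *\<^sub>C x) - x) \<in> compact_ops \<and>
      (\<lambda>x. (T (R x) - l *\<^sub>C R x) - x) \<in> compact_ops"
    using R compact_ops_zero by (intro exI[of _ R]) simp
  then show ?thesis
    by (simp add: ess_spectrum_iff[OF T])
qed

text \<open>For \<open>l < a\<close> the operator \<open>T - l\<close> is coercive, for
  \<open>l > b\<close> its negative is; either way \<open>T - l\<close> is invertible
  outright.\<close>

lemma real_ess_spectrum_bounds:
  fixes T :: "'a::complex_hilbert \<Rightarrow> 'a"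
  assumes T: "bounded_op T"
    and range: "\<And>x. a * (norm x)\<^sup>2 \<le> inner (T x) x" "\<And>x. inner (T x) x \<le> b * (norm x)\<^sup>2"
    and l: "complex_of_real l \<in> ess_spectrum T"
  shows "a \<le> l" "l \<le> b"
proof -
  define S where "S x = T x - complex_of_real l *\<^sub>C x" for x
  have S: "bounded_op S"
    unfolding S_def by (rule bounded_op_shift[OF T])
  have inner_S: "inner (S x) x = inner (T x) x - l * (norm x)\<^sup>2" for x
    by (simp add: S_def inner_diff_left scaleC_of_real power2_norm_eq_inner)
  show "a \<le> l"
  proof (rule ccontr)
    assume "\<not> a \<le> l"
    then have "a - l > 0"
      by simp
    moreover have "(a - l) * (norm x)\<^sup>2 \<le> inner (S x) x" for x
      using range(1)[of x] by (simp add: inner_S left_diff_distrib)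
    ultimately obtain R where R: "bounded_op R" "\<forall>x. R (S x) = x" "\<forall>x. S (R x) = x"
      using coercive_op_invertible[OF S] by blast
    have "complex_of_real l \<notin> ess_spectrum T"
      using R(2,3) by (intro not_ess_spectrum_invertible[OF T R(1)]) (simp_all add: S_def)
    then show False
      using l by contradiction
  qed
  show "l \<le> b"
  proof (rule ccontr)
    assume "\<not> l \<le> b"
    then have "l - b > 0"
      by simp
    moreover have "(l - b) * (norm x)\<^sup>2 \<le> inner (- S x) x" for x
      using range(2)[of x] by (simp add: inner_S left_diff_distrib)
    ultimately obtain R where R: "bounded_op R" "\<forall>x. R (- S x) = x" "\<forall>x. - S (R x) = x"
      using coercive_op_invertible[OF bounded_op_uminus[OF S]] by blast
    have "- R (S x) = x" "S (- R x) = x" for x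
      using spec[OF R(2), of x] spec[OF R(3), of x]
      by (simp_all add: bounded_opD[OF R(1)] bounded_opD[OF S])
    then have "complex_of_real l \<notin> ess_spectrum T"
      by (intro not_ess_spectrum_invertible[OF T bounded_op_uminus[OF R(1)]]) (simp_all add: S_def)
    then show False
      using l by contradiction
  qed
qed

section \<open>Compactness of Hilbert-Schmidt operators\<close>

text \<open>A finite net of the approximating compact set is also a net for \<open>A\<close>, which
  gives total boundedness. This serves for norm limits of finite-rank operators.\<close>

lemma compact_closure_if_approximable:
  fixes A :: "'a::complete_space set"
  assumes "\<And>\<epsilon>. \<epsilon> > 0 \<Longrightarrow> \<exists>D. compact D \<and> (\<forall>x\<in>A. \<exists>y\<in>D. dist y x \<le> \<epsilon>)"
  shows "compact (closure A)"
  unfolding compact_eq_totally_bounded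
proof (intro conjI allI impI)
  show "complete (closure A)"
    by (simp add: complete_eq_closed)
  fix \<epsilon> :: real assume "\<epsilon> > 0"
  then obtain D where D: "compact D" "\<And>x. x \<in> A \<Longrightarrow> \<exists>y\<in>D. dist y x \<le> \<epsilon> / 4"
    using assms[of "\<epsilon> / 4"] by auto
  obtain k where k: "finite k" "D \<subseteq> (\<Union>x\<in>k. ball x (\<epsilon> / 4))"
    using D(1) \<open>\<epsilon> > 0\<close> unfolding compact_eq_totally_bounded by (meson divide_pos_pos zero_less_numeral)
  have "\<exists>z\<in>k. dist z x < \<epsilon>" if x: "x \<in> closure A" for x
  proof -
    obtain x' where x': "x' \<in> A" "dist x' x < \<epsilon> / 4"
      using x \<open>\<epsilon> > 0\<close> unfolding closure_approachable by (meson divide_pos_pos zero_less_numeral)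
    obtain y where y: "y \<in> D" "dist y x' \<le> \<epsilon> / 4"
      using D(2)[OF x'(1)] by blast
    obtain z where z: "z \<in> k" "dist z y < \<epsilon> / 4"
      using k(2) y(1) by auto
    have "dist z x < \<epsilon>"
      using x'(2) y(2) z(2) dist_triangle[of z x y] dist_triangle[of y x x'] \<open>\<epsilon> > 0\<close> by linarith
    with z(1) show ?thesis
      by blast
  qed
  then show "\<exists>k. finite k \<and> closure A \<subseteq> (\<Union>x\<in>k. ball x \<epsilon>)"
    using k(1) by (intro exI[of _ k]) (auto simp: subset_eq)
qed

text \<open>Such a set contains the image of the unit ball under a finite-rank truncation. It is
  built by adding one compact disc of multiples of \<open>g n\<close> at a time.\<close>

lemma compact_set_of_combinations:
  fixes g :: "nat \<Rightarrow> 'a::complex_hilbert"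
  shows "\<exists>D. compact D \<and> (\<forall>c. (\<forall>k<n. cmod (c k) \<le> 1) \<longrightarrow> (\<Sum>k<n. c k *\<^sub>C g k) \<in> D)"
proof (induction n)
  case 0
  show ?case
    by (intro exI[of _ "{0}"]) simp
next
  case (Suc n)
  then obtain D where D: "compact D" "\<And>c. (\<forall>k<n. cmod (c k) \<le> 1) \<Longrightarrow> (\<Sum>k<n. c k *\<^sub>C g k) \<in> D"
    by blast
  have "bounded_linear (\<lambda>c. c *\<^sub>C g n)"
  proof (rule bounded_linear_intro)
    show "(r *\<^sub>R c) *\<^sub>C g n = r *\<^sub>R (c *\<^sub>C g n)" for r c
      by (simp add: scaleR_conv_of_real flip: scaleC_scaleC scaleC_of_real)
  qed (auto simp: scaleC_add_left norm_scaleC)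
  then have "compact ((\<lambda>c. c *\<^sub>C g n) ` cball 0 1)"
    by (intro compact_continuous_image linear_continuous_on) auto
  then have "compact {x + y | x y. x \<in> D \<and> y \<in> (\<lambda>c. c *\<^sub>C g n) ` cball 0 1}"
    by (rule compact_sums[OF D(1)])
  moreover have "(\<Sum>k<Suc n. c k *\<^sub>C g k) \<in> {x + y | x y. x \<in> D \<and> y \<in> (\<lambda>c. c *\<^sub>C g n) ` cball 0 1}"
    if c: "\<forall>k<Suc n. cmod (c k) \<le> 1" for c
  proof -
    have "(\<Sum>k<n. c k *\<^sub>C g k) \<in> D" "c n *\<^sub>C g n \<in> (\<lambda>c. c *\<^sub>C g n) ` cball 0 1"
      using c by (auto intro!: D(2))
    then show ?thesis
      by auto
  qed
  ultimately show ?case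
    by blast
qed

lemma bounded_op_sum:
  assumes "bounded_op K"
  shows "K (\<Sum>k\<in>A. c k *\<^sub>C g k) = (\<Sum>k\<in>A. c k *\<^sub>C K (g k))"
  by (induction A rule: infinite_finite_induct) (simp_all add: bounded_opD[OF assms])

text \<open>Truncating the expansion of \<open>x\<close> after \<open>n\<close> terms changes
  \<open>K x\<close> by at most the square root of a tail of the series, by Cauchy-Schwarz and
  Bessel, uniformly over the unit ball.\<close>

lemma hilbert_schmidt_compact:
  fixes K :: "'a::complex_hilbert \<Rightarrow> 'a"
  assumes K: "bounded_op K" and e: "orthonormal_basis e"
    and summable: "summable (\<lambda>n. (norm (K (e n)))\<^sup>2)"
  shows "K \<in> compact_ops"
proof -
  have "compact (closure (K ` cball 0 1))"
  proof (rule compact_closure_if_approximable)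
    fix \<epsilon> :: real assume "\<epsilon> > 0"
    then obtain n where n: "\<And>m. norm (\<Sum>k=n..<m. (norm (K (e k)))\<^sup>2) < \<epsilon>\<^sup>2"
      using summable unfolding summable_Cauchy by (meson order_refl zero_less_power)
    obtain D where D: "compact D"
      "\<And>c. (\<forall>k<n. cmod (c k) \<le> 1) \<Longrightarrow> (\<Sum>k<n. c k *\<^sub>C K (e k)) \<in> D"
      using compact_set_of_combinations[of n "\<lambda>k. K (e k)"] by blast
    have "\<exists>y\<in>D. dist y (K x) \<le> \<epsilon>" if x: "norm x \<le> 1" for x
    proof
      define P where "P m = K (partial_expansion x e m)" for m
      have P: "P m = (\<Sum>k<m. cinner x (e k) *\<^sub>C K (e k))" for m
        by (simp add: P_def partial_expansion_def bounded_op_sum[OF K])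
      have "cmod (cinner x (e k)) \<le> 1" for k
        using cinner_norm_le[of x "e k"] x by (simp add: orthonormal_basis_norm[OF e])
      then show "P n \<in> D"
        unfolding P by (intro D(2)) simp
      have "norm (P n - P m) \<le> \<epsilon>" if "n \<le> m" for m
      proof (rule power2_le_imp_le)
        have "P m - P n = (\<Sum>k=n..<m. cinner x (e k) *\<^sub>C K (e k))"
          unfolding P using that sum_diff_nat_ivl[of 0 n m] by (simp add: atLeast0LessThan)
        then have "norm (P n - P m) = norm (\<Sum>k=n..<m. cinner x (e k) *\<^sub>C K (e k))"
          by (simp add: norm_minus_commute)
        also have "\<dots> \<le> (\<Sum>k=n..<m. cmod (cinner x (e k)) * norm (K (e k)))"
          by (rule sum_norm_le) (simp add: norm_scaleC)
        finally have "(norm (P n - P m))\<^sup>2 \<le> (\<Sum>k=n..<m. cmod (cinner x (e k)) * norm (K (e k)))\<^sup>2"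
          by (rule power_mono) simp
        also have "\<dots> \<le> (\<Sum>k=n..<m. (cmod (cinner x (e k)))\<^sup>2) * (\<Sum>k=n..<m. (norm (K (e k)))\<^sup>2)"
          by (rule Cauchy_Schwarz_ineq_sum)
        also have "\<dots> \<le> 1 * \<epsilon>\<^sup>2"
        proof (rule mult_mono)
          have "(\<Sum>k=n..<m. (cmod (cinner x (e k)))\<^sup>2) \<le> (\<Sum>k<m. (cmod (cinner x (e k)))\<^sup>2)"
            by (rule sum_mono2) auto
          also have "\<dots> \<le> (norm x)\<^sup>2"
            by (rule bessel_inequality[OF orthonormal_basis_upto[OF e]])
          also have "\<dots> \<le> 1"
            using x by (simp add: power_le_one)
          finally show "(\<Sum>k=n..<m. (cmod (cinner x (e k)))\<^sup>2) \<le> 1" .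
          show "(\<Sum>k=n..<m. (norm (K (e k)))\<^sup>2) \<le> \<epsilon>\<^sup>2"
            using n[of m] by simp
        qed (auto intro: sum_nonneg)
        finally show "(norm (P n - P m))\<^sup>2 \<le> \<epsilon>\<^sup>2"
          by simp
      qed (use \<open>\<epsilon> > 0\<close> in simp)
      moreover have "bounded_linear K"
        using K by (simp add: bounded_op_def)
      then have "P \<longlonglongrightarrow> K x"
        unfolding P_def using orthonormal_basis_expansion[OF e] by (rule bounded_linear.tendsto)
      then have "(\<lambda>m. norm (P n - P m)) \<longlonglongrightarrow> norm (P n - K x)"
        by (intro tendsto_intros)
      ultimately have "norm (P n - K x) \<le> \<epsilon>"
        using LIMSEQ_le_const2 by blast
      then show "dist (P n) (K x) \<le> \<epsilon>"
        by (simp add: dist_norm)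
    qed
    with D(1) show "\<exists>D. compact D \<and> (\<forall>x\<in>K ` cball 0 1. \<exists>y\<in>D. dist y x \<le> \<epsilon>)"
      by auto
  qed
  with K show ?thesis
    by (simp add: compact_ops_def)
qed

section \<open>Essential spectrum under a quadratic relation modulo compacts\<close>

text \<open>From \<open>(X - a)(X - b) - (l - a)(l - b) = (X - l)(X - (a + b - l))\<close> and
  compactness of \<open>(T - a)(T - b)\<close>, the operator \<open>T - (a + b - l)\<close> divided
  by \<open>-(l - a)(l - b)\<close> is a parametrix of \<open>T - l\<close> whenever
  \<open>l\<close> is neither root.\<close>

lemma ess_spectrum_subset_roots:
  fixes T :: "'a::complex_hilbert \<Rightarrow> 'a"
  assumes T: "bounded_op T"
    and K: "(\<lambda>x. T (T x) - (a + b) *\<^sub>C T x + (a * b) *\<^sub>C x) \<in> compact_ops"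
  shows "ess_spectrum T \<subseteq> {a, b}"
proof
  fix l assume l: "l \<in> ess_spectrum T"
  show "l \<in> {a, b}"
  proof (rule ccontr)
    assume "l \<notin> {a, b}"
    then have "(l - a) * (l - b) \<noteq> 0"
      by simp
    define c where "c = - 1 / ((l - a) * (l - b))"
    have c: "c * (l * (a + b - l)) = c * (a * b) + 1"
    proof -
      have "c * ((l - a) * (l - b)) = - 1"
        using \<open>(l - a) * (l - b) \<noteq> 0\<close> by (simp add: c_def)
      moreover have "l * (a + b - l) = a * b - (l - a) * (l - b)"
        by (simp add: algebra_simps)
      ultimately show ?thesis
        by (simp add: right_diff_distrib)
    qed
    define R where "R x = c *\<^sub>C (T x - (a + b - l) *\<^sub>C x)" for x
    define K' where "K' x = c *\<^sub>C (T (T x) - (a + b) *\<^sub>C T x + (a * b) *\<^sub>C x)" for x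
    have "bounded_op R"
      using bounded_op_comp[OF bounded_op_scaleC bounded_op_shift[OF T], of c "a + b - l"]
      by (simp add: R_def[abs_def] comp_def)
    have "K' \<in> compact_ops"
      using compact_ops_left[OF bounded_op_scaleC K, of c] by (simp add: K'_def[abs_def] comp_def)
    have 1: "T (R x) - l *\<^sub>C R x - x = K' x" for x
    proof -
      have "T (R x) - l *\<^sub>C R x =
          c *\<^sub>C T (T x) - (c * (a + b)) *\<^sub>C T x + (c * (l * (a + b - l))) *\<^sub>C x"
        by (simp add: R_def bounded_opD[OF T] scaleC_scaleC complex_vector.scale_right_diff_distrib
          complex_vector.scale_left_diff_distrib scaleC_add_left scaleC_add_right algebra_simps)
      then show ?thesis
        unfolding c by (simp add: K'_def scaleC_scaleC scaleC_add_left scaleC_add_right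
          complex_vector.scale_right_diff_distrib distrib_left)
    qed
    have 2: "R (T x - l *\<^sub>C x) = T (R x) - l *\<^sub>C R x" for x
      by (simp add: R_def bounded_opD[OF T] scaleC_scaleC complex_vector.scale_right_diff_distrib
        algebra_simps)
    have "\<exists>R. bounded_op R \<and> (\<lambda>x. R (T x - l *\<^sub>C x) - x) \<in> compact_ops \<and>
        (\<lambda>x. (T (R x) - l *\<^sub>C R x) - x) \<in> compact_ops"
      using \<open>bounded_op R\<close> \<open>K' \<in> compact_ops\<close> by (intro exI[of _ R]) (simp add: 1 2)
    then show False
      using l by (simp add: ess_spectrum_iff[OF T])
  qed
qed

lemma bounded_op_shiftR: "bounded_op T \<Longrightarrow> bounded_op (\<lambda>x. T x - c *\<^sub>R x)"
  using bounded_op_shift[of T "complex_of_real c"] by (simp add: scaleC_of_real)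

lemma selfadjoint_shiftR: "selfadjoint T \<Longrightarrow> selfadjoint (\<lambda>x. T x - c *\<^sub>R x)"
  using selfadjoint_shift[of T c] by (simp add: scaleC_of_real)

text \<open>Both \<open>T - a\<close> and \<open>b - T\<close> are positive with form at most
  \<open>M\<close>. Hence unit vectors with value near an endpoint are approximate eigenvectors, and
  exact ones at the endpoint. Taking \<open>M\<close> apart from \<open>b - a\<close> keeps it
  positive when \<open>a = b\<close>.\<close>

lemma shift_norm_le:
  fixes T :: "'a::complex_hilbert \<Rightarrow> 'a"
  assumes T: "bounded_op T" "selfadjoint T"
    and range: "\<And>x. a * (norm x)\<^sup>2 \<le> inner (T x) x" "\<And>x. inner (T x) x \<le> b * (norm x)\<^sup>2"
    and M: "M > 0" "b - a \<le> M"
  shows "(norm (T x - a *\<^sub>R x))\<^sup>2 \<le> M * (inner (T x) x - a * (norm x)\<^sup>2)"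
    and "(norm (T x - b *\<^sub>R x))\<^sup>2 \<le> M * (b * (norm x)\<^sup>2 - inner (T x) x)"
proof -
  have le: "b * (norm x)\<^sup>2 - a * (norm x)\<^sup>2 \<le> M * (norm x)\<^sup>2" for x :: 'a
    using mult_right_mono[OF M(2), of "(norm x)\<^sup>2"] by (simp add: left_diff_distrib)
  have inner: "inner (T x - c *\<^sub>R x) x = inner (T x) x - c * (norm x)\<^sup>2" for c x
    by (simp add: inner_diff_left power2_norm_eq_inner)
  have "(norm (T x - a *\<^sub>R x))\<^sup>2 \<le> M * inner (T x - a *\<^sub>R x) x"
  proof (rule positive_op_norm_le[OF bounded_op_shiftR[OF T(1)] selfadjoint_shiftR[OF T(2)] M(1)])
    show "0 \<le> inner (T x - a *\<^sub>R x) x" "inner (T x - a *\<^sub>R x) x \<le> M * (norm x)\<^sup>2" for x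
      using range[of x] le[of x] unfolding inner by linarith+
  qed
  then show "(norm (T x - a *\<^sub>R x))\<^sup>2 \<le> M * (inner (T x) x - a * (norm x)\<^sup>2)"
    by (simp add: inner)
  have "(norm (- (T x - b *\<^sub>R x)))\<^sup>2 \<le> M * inner (- (T x - b *\<^sub>R x)) x"
  proof (rule positive_op_norm_le[OF bounded_op_uminus[OF bounded_op_shiftR[OF T(1)]]
        selfadjoint_uminus[OF selfadjoint_shiftR[OF T(2)]] M(1)])
    show "0 \<le> inner (- (T x - b *\<^sub>R x)) x" "inner (- (T x - b *\<^sub>R x)) x \<le> M * (norm x)\<^sup>2" for x
      using range[of x] le[of x] unfolding inner_minus_left inner by linarith+
  qed
  then show "(norm (T x - b *\<^sub>R x))\<^sup>2 \<le> M * (b * (norm x)\<^sup>2 - inner (T x) x)"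
    unfolding inner_minus_left inner norm_minus_cancel by simp
qed

text \<open>
  Summability makes \<open>(T - a)(T - b)\<close> a Hilbert-Schmidt operator: of its two commuting factors,
  the one belonging to the endpoint nearer to \<open>d\<^sub>n\<close> is small on the \<open>n\<close>-th basis vector.
\<close>

lemma ess_spectrum_subset_if_summable:
  fixes T :: "'a::complex_hilbert \<Rightarrow> 'a"
  assumes T: "bounded_op T" "selfadjoint T"
    and range: "\<And>x. a * (norm x)\<^sup>2 \<le> inner (T x) x" "\<And>x. inner (T x) x \<le> b * (norm x)\<^sup>2"
    and e: "orthonormal_basis e"
    and summable: "summable (\<lambda>n. min (inner (T (e n)) (e n) - a) (b - inner (T (e n)) (e n)))"
  shows "ess_spectrum T \<subseteq> {complex_of_real a, complex_of_real b}"
proof (rule ess_spectrum_subset_roots[OF T(1)])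
  define M where "M = \<bar>b - a\<bar> + 1"
  have M: "M > 0" "b - a \<le> M"
    by (auto simp: M_def)
  note bounds = shift_norm_le[OF T range M]
  define K where "K x = T (T x) - (complex_of_real a + complex_of_real b) *\<^sub>C T x
      + (complex_of_real a * complex_of_real b) *\<^sub>C x" for x
  have K_eq: "K x = T (T x) - (a + b) *\<^sub>R T x + (a * b) *\<^sub>R x" for x
    unfolding K_def of_real_add[symmetric] of_real_mult[symmetric] scaleC_of_real ..
  \<comment> \<open>The factors commute, so either may act first; bounding the second factor leaves
    the distance of the diagonal entry to \<open>a\<close> or to \<open>b\<close> at choice.\<close>
  have K1: "K x = T (T x - a *\<^sub>R x) - b *\<^sub>R (T x - a *\<^sub>R x)" for x
    by (simp add: K_eq bounded_opD[OF T(1)] algebra_simps)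
  have K2: "K x = T (T x - b *\<^sub>R x) - a *\<^sub>R (T x - b *\<^sub>R x)" for x
    by (simp add: K_eq bounded_opD[OF T(1)] algebra_simps)
  have a_le: "(norm (T x - a *\<^sub>R x))\<^sup>2 \<le> M\<^sup>2 * (norm x)\<^sup>2" for x
  proof -
    have "inner (T x) x - a * (norm x)\<^sup>2 \<le> M * (norm x)\<^sup>2"
      using range(2)[of x] mult_right_mono[OF M(2), of "(norm x)\<^sup>2"] by (simp add: left_diff_distrib)
    from order_trans[OF bounds(1)[of x] mult_left_mono[OF this]] M(1) show ?thesis
      by (simp add: power2_eq_square[of M] mult.assoc)
  qed
  have b_le: "(norm (T x - b *\<^sub>R x))\<^sup>2 \<le> M\<^sup>2 * (norm x)\<^sup>2" for x
  proof -
    have "b * (norm x)\<^sup>2 - inner (T x) x \<le> M * (norm x)\<^sup>2"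
      using range(1)[of x] mult_right_mono[OF M(2), of "(norm x)\<^sup>2"] by (simp add: left_diff_distrib)
    from order_trans[OF bounds(2)[of x] mult_left_mono[OF this]] M(1) show ?thesis
      by (simp add: power2_eq_square[of M] mult.assoc)
  qed
  have "(norm (K (e n)))\<^sup>2 \<le>
      M^3 * min (inner (T (e n)) (e n) - a) (b - inner (T (e n)) (e n))" for n
  proof -
    have "(norm (K (e n)))\<^sup>2 \<le> M\<^sup>2 * (norm (T (e n) - a *\<^sub>R e n))\<^sup>2"
      unfolding K1 by (rule b_le)
    also have "\<dots> \<le> M\<^sup>2 * (M * (inner (T (e n)) (e n) - a))"
      using bounds(1)[of "e n"] by (intro mult_left_mono) (simp_all add: orthonormal_basis_norm[OF e])
    finally have 1: "(norm (K (e n)))\<^sup>2 \<le> M^3 * (inner (T (e n)) (e n) - a)"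
      by (simp add: power3_eq_cube power2_eq_square mult.assoc)
    have "(norm (K (e n)))\<^sup>2 \<le> M\<^sup>2 * (norm (T (e n) - b *\<^sub>R e n))\<^sup>2"
      unfolding K2 by (rule a_le)
    also have "\<dots> \<le> M\<^sup>2 * (M * (b - inner (T (e n)) (e n)))"
      using bounds(2)[of "e n"] by (intro mult_left_mono) (simp_all add: orthonormal_basis_norm[OF e])
    finally have "(norm (K (e n)))\<^sup>2 \<le> M^3 * (b - inner (T (e n)) (e n))"
      by (simp add: power3_eq_cube power2_eq_square mult.assoc)
    with 1 show ?thesis
      by (simp add: min_def)
  qed
  then have "summable (\<lambda>n. (norm (K (e n)))\<^sup>2)"
    by (intro summable_comparison_test'[OF summable_mult[OF summable, of "M^3"], of 0]) simp
  moreover have "bounded_op K"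
    using bounded_op_add[OF bounded_op_comp[OF
        bounded_op_shift[OF T(1), of "complex_of_real a + complex_of_real b"] T(1)]
        bounded_op_scaleC[of "complex_of_real a * complex_of_real b"]]
    by (simp only: K_def[abs_def] comp_def)
  ultimately show "(\<lambda>x. T (T x) - (complex_of_real a + complex_of_real b) *\<^sub>C T x
      + (complex_of_real a * complex_of_real b) *\<^sub>C x) \<in> compact_ops"
    unfolding K_def[symmetric] by (intro hilbert_schmidt_compact[OF _ e])
qed

section \<open>Weyl's criterion\<close>

text \<open>Weyl's criterion with the orthonormal sequence replaced by orthogonality to any finite
  set, a form suited to recursive choices.\<close>

definition weyl_point :: "('a::complex_hilbert \<Rightarrow> 'a) \<Rightarrow> real \<Rightarrow> bool"
  where "weyl_point T c \<longleftrightarrow> (\<forall>N \<epsilon>. finite N \<longrightarrow> \<epsilon> > 0 \<longrightarrow>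
    (\<exists>v. norm v = 1 \<and> (\<forall>g\<in>N. cinner v g = 0) \<and> norm (T v - c *\<^sub>R v) < \<epsilon>))"

lemma weyl_pointD:
  "weyl_point T c \<Longrightarrow> finite N \<Longrightarrow> \<epsilon> > 0 \<Longrightarrow>
    \<exists>v. norm v = 1 \<and> (\<forall>g\<in>N. cinner v g = 0) \<and> norm (T v - c *\<^sub>R v) < \<epsilon>"
  by (simp add: weyl_point_def)

text \<open>Choose an orthonormal sequence of ever better approximate eigenvectors. If
  \<open>R\<close> were a parametrix, then \<open>x = R (T x - c *\<^sub>R x) - K x\<close> with
  \<open>K\<close> compact would make a subsequence converge, yet its members have mutual distance
  \<open>sqrt 2\<close>.\<close>

lemma weyl_point_ess_spectrum:
  fixes T :: "'a::complex_hilbert \<Rightarrow> 'a"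
  assumes T: "bounded_op T" and w: "weyl_point T c"
  shows "complex_of_real c \<in> ess_spectrum T"
proof (rule ccontr)
  assume "complex_of_real c \<notin> ess_spectrum T"
  then obtain R where R: "bounded_op R" "(\<lambda>x. R (T x - c *\<^sub>R x) - x) \<in> compact_ops"
    by (auto simp: ess_spectrum_iff[OF T] scaleC_of_real)
  define K where "K x = R (T x - c *\<^sub>R x) - x" for x
  have K: "compact (closure (K ` cball 0 1))"
    using R(2) by (simp add: compact_ops_def K_def)
  define P where "P x n v \<longleftrightarrow> norm v = 1 \<and> (\<forall>k<n. cinner v (x k) = 0) \<and>
      norm (T v - c *\<^sub>R v) < 1 / real (Suc n)" for x and n :: nat and v
  have "\<exists>x. \<forall>n. P x n (x n)"
  proof (rule dependent_wellorder_choice)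
    show "P x n v = P x' n v" if "\<And>k. k < n \<Longrightarrow> x k = x' k" for v x x' n
      using that by (simp add: P_def)
    show "\<exists>v. P x n v" for n x
      using weyl_pointD[OF w, of "x ` {..<n}" "1 / real (Suc n)"] by (auto simp: P_def)
  qed
  then obtain x where x: "\<And>n. P x n (x n)"
    by blast
  have norm_x: "norm (x n) = 1" and lim_x: "norm (T (x n) - c *\<^sub>R x n) < 1 / real (Suc n)" for n
    using x[of n] by (simp_all add: P_def)
  have "K (x n) \<in> closure (K ` cball 0 1)" for n
    using norm_x by (intro subsetD[OF closure_subset] imageI) simp
  then obtain z r where r: "strict_mono r" "(\<lambda>n. K (x (r n))) \<longlonglongrightarrow> z"
    using K[unfolded compact_def, rule_format, of "\<lambda>n. K (x n)"] by (auto simp: comp_def)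
  have "(\<lambda>n. T (x n) - c *\<^sub>R x n) \<longlonglongrightarrow> 0"
    by (rule Lim_null_comparison[OF _ LIMSEQ_inverse_real_of_nat])
      (intro always_eventually allI, simp only: inverse_eq_divide less_imp_le[OF lim_x])
  then have "(\<lambda>n. R (T (x n) - c *\<^sub>R x n)) \<longlonglongrightarrow> R 0"
    using R(1) by (intro bounded_linear.tendsto[of R]) (auto simp: bounded_op_def)
  then have "(\<lambda>n. R (T (x (r n)) - c *\<^sub>R x (r n))) \<longlonglongrightarrow> R 0"
    using LIMSEQ_subseq_LIMSEQ[OF _ r(1)] by (auto simp: comp_def)
  from tendsto_diff[OF this r(2)] have "(\<lambda>n. x (r n)) \<longlonglongrightarrow> R 0 - z"
    by (simp add: K_def)
  then have "Cauchy (\<lambda>n. x (r n))"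
    by (rule LIMSEQ_imp_Cauchy)
  then obtain m where "\<forall>i\<ge>m. \<forall>j\<ge>m. norm (x (r i) - x (r j)) < 1"
    using CauchyD[of "\<lambda>n. x (r n)" 1] by auto
  then have m: "norm (x (r m) - x (r (Suc m))) < 1"
    by simp
  have "r m < r (Suc m)"
    using r(1) by (simp add: strict_mono_Suc_iff)
  then have "cinner (x (r (Suc m))) (- x (r m)) = 0"
    using x[of "r (Suc m)"] by (simp add: P_def cinner_minus)
  from pythagoras[OF this] have "(norm (x (r (Suc m)) - x (r m)))\<^sup>2 = 2"
    by (simp add: norm_x)
  moreover have "(norm (x (r (Suc m)) - x (r m)))\<^sup>2 \<le> 1"
    using m by (intro power_le_one) (simp_all add: norm_minus_commute)
  ultimately show False
    by simp
qed

lemma partial_expansion_eq_self: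
  assumes g: "orthonormal_upto g n" and v: "v \<in> cspan (g ` {..<n})"
  shows "partial_expansion v g n = v"
proof -
  define w where "w = v - partial_expansion v g n"
  have "w \<in> cspan (g ` {..<n})"
    unfolding w_def by (intro complex_vector.span_diff v partial_expansion_in_cspan)
  moreover have "cinner w z = 0" if "z \<in> g ` {..<n}" for z
    using partial_expansion_residual_orthogonal[OF g] that by (auto simp: w_def)
  ultimately have "cinner w w = 0"
    using orthogonal_cspan by blast
  then show ?thesis
    by (simp add: w_def cinner_self)
qed

text \<open>The given orthonormal vectors need not be orthogonal to \<open>N\<close>, but the span
  of \<open>card N + 1\<close> of them contains a unit vector that is. As a combination of
  approximate eigenvectors with coefficients of modulus at most 1, it is again one.\<close>

lemma weyl_point_lower_bound:
  fixes T :: "'a::complex_hilbert \<Rightarrow> 'a"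
  assumes T: "bounded_op T" "selfadjoint T"
    and range: "\<And>x. a * (norm x)\<^sup>2 \<le> inner (T x) x" "\<And>x. inner (T x) x \<le> b * (norm x)\<^sup>2"
    and near: "\<And>\<epsilon>. \<epsilon> > 0 \<Longrightarrow> \<exists>x :: nat \<Rightarrow> 'a.
      (\<forall>i j. cinner (x i) (x j) = (if i = j then 1 else 0)) \<and> (\<forall>i. inner (T (x i)) (x i) < a + \<epsilon>)"
  shows "weyl_point T a"
  unfolding weyl_point_def
proof (intro allI impI)
  fix N :: "'a set" and \<epsilon> :: real assume N: "finite N" and "\<epsilon> > 0"
  define m where "m = card N"
  define M where "M = \<bar>b - a\<bar> + 1"
  have M: "M > 0" "b - a \<le> M"
    by (auto simp: M_def)
  \<comment> \<open>The \<open>m + 1\<close> summands with error at most \<delta> add up to half of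
    \<epsilon>; the bound \<open>\<delta>\<^sup>2 / M\<close> on the excess over \<open>a\<close>
    yields this error.\<close>
  define \<delta> where "\<delta> = \<epsilon> / (2 * (real m + 1))"
  have "\<delta> > 0"
    using \<open>\<epsilon> > 0\<close> by (simp add: \<delta>_def)
  then obtain x :: "nat \<Rightarrow> 'a" where x: "\<And>i j. cinner (x i) (x j) = (if i = j then 1 else 0)"
    and xa: "\<And>i. inner (T (x i)) (x i) < a + \<delta>\<^sup>2 / M"
    using near[of "\<delta>\<^sup>2 / M"] M(1) by auto
  have norm_x: "norm (x i) = 1" for i
    by (simp add: norm_eq_1_cinner x)
  have small: "norm (T (x i) - a *\<^sub>R x i) \<le> \<delta>" for i
  proof (rule power2_le_imp_le)
    have "(norm (T (x i) - a *\<^sub>R x i))\<^sup>2 \<le> M * (inner (T (x i)) (x i) - a)"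
      using shift_norm_le(1)[OF T range M, of "x i"] by (simp add: norm_x)
    also have "\<dots> \<le> M * (\<delta>\<^sup>2 / M)"
      using xa[of i] M(1) by (intro mult_left_mono) simp_all
    finally show "(norm (T (x i) - a *\<^sub>R x i))\<^sup>2 \<le> \<delta>\<^sup>2"
      using M(1) by simp
  qed (use \<open>\<delta> > 0\<close> in simp)
  obtain v where v: "v \<in> cspan (x ` {..m})" "norm v = 1" "\<forall>g\<in>N. cinner v g = 0"
    using unit_vector_in_span_orthogonal_finite[OF x N] unfolding m_def by blast
  have "orthonormal_upto x (Suc m)"
    by (simp add: orthonormal_upto_def x norm_x)
  then have "v = partial_expansion v x (Suc m)"
    using v(1) by (intro partial_expansion_eq_self[symmetric]) (simp_all add: lessThan_Suc_atMost)
  then have "T v - a *\<^sub>R v = (\<Sum>i<Suc m. cinner v (x i) *\<^sub>C (T (x i) - a *\<^sub>R x i))"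
    unfolding partial_expansion_def
    using bounded_op_sum[OF bounded_op_shiftR[OF T(1), of a], where c = "\<lambda>i. cinner v (x i)"
      and g = x and A = "{..<Suc m}"] by metis
  then have "norm (T v - a *\<^sub>R v) \<le> (\<Sum>i<Suc m. norm (cinner v (x i) *\<^sub>C (T (x i) - a *\<^sub>R x i)))"
    by (simp only: norm_sum)
  also have "\<dots> \<le> (\<Sum>i<Suc m. \<delta>)"
  proof (rule sum_mono)
    fix i
    have "cmod (cinner v (x i)) \<le> 1"
      using cinner_norm_le[of v "x i"] v(2) by (simp add: norm_x)
    then have "cmod (cinner v (x i)) * norm (T (x i) - a *\<^sub>R x i) \<le> 1 * \<delta>"
      by (intro mult_mono small) simp_all
    then show "norm (cinner v (x i) *\<^sub>C (T (x i) - a *\<^sub>R x i)) \<le> \<delta>"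
      by (simp add: norm_scaleC)
  qed
  also have "\<dots> = \<epsilon> / 2"
    by (simp add: \<delta>_def field_simps)
  also have "\<dots> < \<epsilon>"
    using \<open>\<epsilon> > 0\<close> by simp
  finally show "\<exists>v. norm v = 1 \<and> (\<forall>g\<in>N. cinner v g = 0) \<and> norm (T v - a *\<^sub>R v) < \<epsilon>"
    using v by blast
qed

text \<open>Transfers the result on the lower endpoint to the upper one.\<close>

lemma weyl_point_uminus: "weyl_point (\<lambda>x. - T x) (- c) \<longleftrightarrow> weyl_point T c"
proof -
  have "norm (- T v - (- c) *\<^sub>R v) = norm (T v - c *\<^sub>R v)" for v
    using norm_minus_cancel[of "T v - c *\<^sub>R v"] by simp
  then show ?thesis
    by (simp add: weyl_point_def)
qed

section \<open>Diagonals\<close>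

lemma subspace_eigenspace:
  assumes "bounded_op T"
  shows "complex_vector.subspace (eigenspace T c)"
  by (rule complex_vector.subspaceI)
    (auto simp: eigenspace_def bounded_opD[OF assms] scaleC_add_right scaleC_scaleC mult.commute)

lemma eigenspace_of_real: "x \<in> eigenspace T (complex_of_real c) \<longleftrightarrow> T x = c *\<^sub>R x"
  by (simp add: eigenspace_def scaleC_of_real)

lemma orthonormal_family_in_subspace:
  fixes V :: "'a::complex_hilbert set" and Z :: "nat set"
  assumes V: "complex_vector.subspace V" and le: "ecard Z \<le> ecdim V"
  shows "\<exists>f. (\<forall>k\<in>Z. f k \<in> V) \<and> (\<forall>i\<in>Z. \<forall>j\<in>Z. cinner (f i) (f j) = (if i = j then 1 else 0))"
proof -
  define P where "P f n v \<longleftrightarrow> n \<in> Z \<longrightarrow>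
    v \<in> V \<and> norm v = 1 \<and> (\<forall>k<n. k \<in> Z \<longrightarrow> cinner v (f k) = 0)" for f :: "nat \<Rightarrow> 'a" and n v
  have "\<exists>f. \<forall>n. P f n (f n)"
  proof (rule dependent_wellorder_choice)
    show "P f n v = P g n v" if "\<And>k. k < n \<Longrightarrow> f k = g k" for v f g n
      using that by (simp add: P_def)
  next
    fix n f assume f: "\<And>k. k < n \<Longrightarrow> P f k (f k)"
    show "\<exists>v. P f n v"
    proof (cases "n \<in> Z")
      case True
      define A where "A = {k\<in>Z. k < n}"
      have A: "finite A" "f ` A \<subseteq> V"
        using f by (auto simp: A_def P_def)
      \<comment> \<open>If the vectors chosen so far spanned \<open>V\<close>, its dimension would
        be at most \<open>card A\<close>; but \<open>A\<close> is a proper subset of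
        \<open>Z\<close>, as \<open>n\<close> itself is missing.\<close>
      have "\<not> V \<subseteq> cspan (f ` A)"
      proof
        assume sub: "V \<subseteq> cspan (f ` A)"
        then have "cdim V \<le> card (f ` A)"
          using A(1) by (intro complex_vector.dim_le_card) auto
        also have "\<dots> \<le> card A"
          by (rule card_image_le[OF A(1)])
        finally have "cdim V \<le> card A" .
        moreover have "ecdim V = enat (cdim V)"
          using sub A(1) by (auto simp: ecdim_def)
        ultimately have "ecard Z \<le> enat (card A)"
          using le by (metis enat_ord_simps(1) order_trans)
        then have "finite Z" "card Z \<le> card A"
          by (auto simp: ecard_def split: if_splits)
        moreover have "A \<subset> Z"
          using True by (auto simp: A_def)
        ultimately show False
          using psubset_card_mono[of Z A] by simp
      qed
      then obtain v where "v \<in> V" "norm v = 1" "\<forall>s\<in>f ` A. cinner v s = 0"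
        using unit_vector_orthogonal_finite[OF V _ finite_imageI[OF A(1)] A(2)] by blast
      then show ?thesis
        by (intro exI[of _ v]) (auto simp: P_def A_def)
    qed (simp add: P_def)
  qed
  then obtain f where f: "\<And>n. P f n (f n)"
    by blast
  have "cinner (f i) (f j) = (if i = j then 1 else 0)" if "i \<in> Z" "j \<in> Z" for i j
  proof (cases i j rule: linorder_cases)
    case less
    then have "cinner (f j) (f i) = 0"
      using f[of j] that by (simp add: P_def)
    with less show ?thesis
      by (simp add: cinner_eq_0_commute[of "f i" "f j"])
  next
    case equal
    then show ?thesis
      using f[of j] that by (simp add: P_def norm_eq_1_cinner)
  next
    case greater
    then show ?thesis
      using f[of i] that by (simp add: P_def)
  qed
  then show ?thesis
    using f by (intro exI[of _ f]) (simp add: P_def)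
qed

text \<open>Yields the multiplicity bounds for a diagonal, since basis vectors with an extreme
  diagonal entry are eigenvectors.\<close>

lemma orthonormal_card_le_dim:
  fixes e :: "nat \<Rightarrow> 'a::complex_hilbert"
  assumes e: "\<And>i j. cinner (e i) (e j) = (if i = j then 1 else 0)" and V: "e ` Z \<subseteq> V"
  shows "ecard Z \<le> ecdim V"
proof (cases "\<exists>B. finite B \<and> V \<subseteq> cspan B")
  case True
  then obtain B where B: "finite B" "V \<subseteq> cspan B"
    by blast
  obtain B' where B': "B' \<subseteq> V" "complex_vector.independent B'" "V \<subseteq> cspan B'" "card B' = cdim V"
    by (rule complex_vector.basis_exists)
  have "finite B'"
    using complex_vector.independent_span_bound[OF B(1) B'(2)] B'(1) B(2) by blast
  moreover have "complex_vector.independent (e ` Z)"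
    by (rule orthonormal_independent) (rule e)
  ultimately have fin: "finite (e ` Z)" "card (e ` Z) \<le> cdim V"
    using complex_vector.independent_span_bound[of B' "e ` Z"] V B'(3,4) by auto
  have "inj_on e Z"
  proof (rule inj_onI)
    fix i j assume "e i = e j"
    then show "i = j"
      using e[of i j] e[of j j] by (simp split: if_splits)
  qed
  then have "finite Z" "card Z \<le> cdim V"
    using fin by (simp_all add: finite_image_iff card_image)
  with True show ?thesis
    by (simp add: ecard_def ecdim_def)
next
  case False
  then have "ecdim V = \<infinity>"
    unfolding ecdim_def by (rule if_not_P)
  then show ?thesis
    by simp
qed

lemma eigenvectors_orthogonal:
  assumes T: "selfadjoint T" and "T x = \<alpha> *\<^sub>R x" "T y = \<beta> *\<^sub>R y" "\<alpha> \<noteq> \<beta>"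
  shows "cinner x y = 0"
proof -
  have "complex_of_real \<alpha> * cinner x y = complex_of_real \<beta> * cinner x y"
    using selfadjointD[OF T, of x y] assms(2,3) by (simp add: cinner_scaleR_left cinner_scaleR_right)
  then show ?thesis
    using \<open>\<alpha> \<noteq> \<beta>\<close> by simp
qed

text \<open>
  Removing eigenvectors for \<open>\<alpha>\<close> must not spoil the approximate eigenvectors. If only finitely
  many are removed, \<open>\<beta> - T\<close> moves approximate eigenvectors for \<open>\<alpha>\<close> into the orthogonal complement
  of the eigenspace of \<open>\<beta>\<close>; otherwise every second eigenvector is held back.
\<close>

lemma eigenvector_family_with_weyl_vectors:
  fixes T :: "'a::complex_hilbert \<Rightarrow> 'a" and Z :: "nat set"
  assumes T: "bounded_op T" "selfadjoint T" and "\<alpha> \<noteq> \<beta>" and w: "weyl_point T \<alpha>"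
    and le: "ecard Z \<le> ecdim (eigenspace T (complex_of_real \<alpha>))"
  shows "\<exists>f. (\<forall>k\<in>Z. T (f k) = \<alpha> *\<^sub>R f k) \<and>
    (\<forall>i\<in>Z. \<forall>j\<in>Z. cinner (f i) (f j) = (if i = j then 1 else 0)) \<and>
    (\<forall>N \<epsilon>. finite N \<longrightarrow> \<epsilon> > 0 \<longrightarrow> (\<exists>v. norm v = 1 \<and> (\<forall>g\<in>N. cinner v g = 0) \<and>
      (\<forall>k\<in>Z. cinner v (f k) = 0) \<and> (\<forall>y. T y = \<beta> *\<^sub>R y \<longrightarrow> cinner v y = 0) \<and>
      norm (T v - \<alpha> *\<^sub>R v) < \<epsilon>))"
proof (cases "finite Z")
  case True
  obtain f where f: "\<forall>k\<in>Z. T (f k) = \<alpha> *\<^sub>R f k"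
    "\<forall>i\<in>Z. \<forall>j\<in>Z. cinner (f i) (f j) = (if i = j then 1 else 0)"
    using orthonormal_family_in_subspace[OF subspace_eigenspace[OF T(1)] le]
    unfolding eigenspace_of_real by blast
  \<comment> \<open>\<open>S\<close> is selfadjoint, commutes with \<open>T\<close> and kills the
    eigenspace of \<beta>, so its range is orthogonal to that eigenspace.\<close>
  define S where "S x = \<beta> *\<^sub>R x - T x" for x
  have S: "bounded_op S"
    using bounded_op_uminus[OF bounded_op_shiftR[OF T(1), of \<beta>]] by (simp add: S_def[abs_def])
  have S_adj: "cinner (S x) y = cinner x (S y)" for x y
    by (simp add: S_def cinner_diff_left cinner_diff_right cinner_scaleR_left cinner_scaleR_right
      selfadjointD[OF T(2)])
  obtain B where B: "B > 0" "\<And>x. norm (S x) \<le> norm x * B"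
    using S bounded_linear.pos_bounded unfolding bounded_op_def by blast
  have "\<exists>v. norm v = 1 \<and> (\<forall>g\<in>N. cinner v g = 0) \<and> (\<forall>k\<in>Z. cinner v (f k) = 0) \<and>
      (\<forall>y. T y = \<beta> *\<^sub>R y \<longrightarrow> cinner v y = 0) \<and> norm (T v - \<alpha> *\<^sub>R v) < \<epsilon>"
    if N: "finite N" and "\<epsilon> > 0" for N \<epsilon>
  proof -
    define c where "c = \<bar>\<beta> - \<alpha>\<bar>"
    have "c > 0"
      using \<open>\<alpha> \<noteq> \<beta>\<close> by (simp add: c_def)
    \<comment> \<open>The first bound keeps \<open>S v\<close> at norm at least
      \<open>c / 2\<close>; the second keeps the error below \<epsilon> after applying
      \<open>S\<close> and normalising.\<close>
    define \<delta> where "\<delta> = min (c / 2) (\<epsilon> * c / (4 * B))"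
    have \<delta>: "\<delta> > 0" "\<delta> \<le> c / 2" "\<delta> \<le> \<epsilon> * c / (4 * B)"
      using \<open>c > 0\<close> \<open>\<epsilon> > 0\<close> B(1) by (simp_all add: \<delta>_def)
    \<comment> \<open>Orthogonality of \<open>v\<close> to the image of \<open>N\<close> under
      \<open>S\<close> passes by selfadjointness to orthogonality of \<open>S v\<close> to
      \<open>N\<close>.\<close>
    have "finite (S ` N \<union> f ` Z)"
      using N True by simp
    from weyl_pointD[OF w this \<delta>(1)] obtain v where v: "norm v = 1"
      "\<forall>g\<in>S ` N \<union> f ` Z. cinner v g = 0" "norm (T v - \<alpha> *\<^sub>R v) < \<delta>"
      by blast
    have "c = norm ((\<beta> - \<alpha>) *\<^sub>R v)"
      using v(1) by (simp add: c_def)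
    also have "\<dots> = norm (S v + (T v - \<alpha> *\<^sub>R v))"
      by (simp add: S_def scaleR_left_diff_distrib)
    also have "\<dots> \<le> norm (S v) + norm (T v - \<alpha> *\<^sub>R v)"
      by (rule norm_triangle_ineq)
    finally have Sv: "norm (S v) \<ge> c / 2"
      using v(3) \<delta>(2) by linarith
    then have "norm (S v) > 0"
      using \<open>c > 0\<close> by linarith
    define u where "u = (1 / norm (S v)) *\<^sub>R S v"
    have "T (S v) - \<alpha> *\<^sub>R S v = S (T v - \<alpha> *\<^sub>R v)"
      by (simp add: S_def bounded_opD[OF T(1)] algebra_simps)
    then have "norm (T (S v) - \<alpha> *\<^sub>R S v) \<le> norm (T v - \<alpha> *\<^sub>R v) * B"
      using B(2) by simp
    also have "\<dots> \<le> \<delta> * B"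
      using v(3) B(1) by (intro mult_right_mono) simp_all
    also have "\<dots> \<le> \<epsilon> * c / (4 * B) * B"
      using \<delta>(3) B(1) by (intro mult_right_mono) simp_all
    also have "\<dots> = \<epsilon> * (c / 4)"
      using B(1) by simp
    also have "\<dots> < \<epsilon> * (c / 2)"
      using \<open>\<epsilon> > 0\<close> \<open>c > 0\<close> by simp
    also have "\<dots> \<le> \<epsilon> * norm (S v)"
      using Sv \<open>\<epsilon> > 0\<close> by (intro mult_left_mono) simp_all
    finally have "norm (T (S v) - \<alpha> *\<^sub>R S v) < \<epsilon> * norm (S v)" .
    moreover have "T u - \<alpha> *\<^sub>R u = (1 / norm (S v)) *\<^sub>R (T (S v) - \<alpha> *\<^sub>R S v)"
      by (simp add: u_def bounded_opD[OF T(1)] scaleR_right_diff_distrib mult.commute)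
    ultimately have "norm (T u - \<alpha> *\<^sub>R u) < \<epsilon>"
      using \<open>norm (S v) > 0\<close> by (simp add: pos_divide_less_eq)
    moreover have "norm u = 1"
      using \<open>norm (S v) > 0\<close> by (simp add: u_def)
    moreover have "cinner u g = 0" if "g \<in> N" for g
      using v(2) that by (simp add: u_def cinner_scaleR_left S_adj)
    moreover have "cinner u (f k) = 0" if "k \<in> Z" for k
    proof -
      have "S (f k) = (\<beta> - \<alpha>) *\<^sub>R f k"
        using f(1) that by (simp add: S_def scaleR_left_diff_distrib)
      moreover have "cinner v (f k) = 0"
        using v(2) that by simp
      ultimately show ?thesis
        by (simp add: u_def cinner_scaleR_left S_adj cinner_scaleR_right)
    qed
    moreover have "cinner u y = 0" if "T y = \<beta> *\<^sub>R y" for y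
    proof -
      have "S y = 0"
        using that by (simp add: S_def)
      then show ?thesis
        by (simp add: u_def cinner_scaleR_left S_adj)
    qed
    ultimately show ?thesis
      by blast
  qed
  with f show ?thesis
    by blast
next
  case False
  then have "ecdim (eigenspace T (complex_of_real \<alpha>)) = \<infinity>"
    using le by (simp add: ecard_def)
  then have "ecard (UNIV :: nat set) \<le> ecdim (eigenspace T (complex_of_real \<alpha>))"
    by simp
  from orthonormal_family_in_subspace[OF subspace_eigenspace[OF T(1)] this]
  obtain g :: "nat \<Rightarrow> 'a" where g: "\<And>k. g k \<in> eigenspace T (complex_of_real \<alpha>)"
    "\<And>i j. cinner (g i) (g j) = (if i = j then 1 else 0)"
    by auto
  define f where "f k = g (2 * k)" for k
  define x where "x k = g (2 * k + 1)" for k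
  have x: "cinner (x i) (x j) = (if i = j then 1 else 0)" for i j
    by (simp add: x_def g(2))
  have xf: "cinner (f i) (x j) = 0" for i j
  proof -
    have "2 * i \<noteq> 2 * j + 1"
      by presburger
    then show ?thesis
      by (simp add: x_def f_def g(2))
  qed
  have "\<exists>v. norm v = 1 \<and> (\<forall>g\<in>N. cinner v g = 0) \<and> (\<forall>k\<in>Z. cinner v (f k) = 0) \<and>
      (\<forall>y. T y = \<beta> *\<^sub>R y \<longrightarrow> cinner v y = 0) \<and> norm (T v - \<alpha> *\<^sub>R v) < \<epsilon>"
    if N: "finite N" and "\<epsilon> > 0" for N \<epsilon>
  proof -
    \<comment> \<open>Combinations of the vectors held back are exact eigenvectors, hence
      automatically orthogonal to the eigenspace of \<beta>.\<close>
    obtain v where v: "v \<in> cspan (x ` {..card N})" "norm v = 1" "\<forall>g\<in>N. cinner v g = 0"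
      using unit_vector_in_span_orthogonal_finite[OF x N] by blast
    have "x ` {..card N} \<subseteq> eigenspace T (complex_of_real \<alpha>)"
      using g(1) by (auto simp: x_def)
    then have "v \<in> eigenspace T (complex_of_real \<alpha>)"
      using v(1) complex_vector.span_minimal[OF _ subspace_eigenspace[OF T(1)]] by blast
    then have Tv: "T v = \<alpha> *\<^sub>R v"
      by (simp add: eigenspace_of_real)
    have vf: "cinner v (f k) = 0" for k
      unfolding cinner_eq_0_commute[of v]
      by (rule orthogonal_cspan[OF _ v(1)]) (auto simp: xf)
    have vy: "cinner v y = 0" if "T y = \<beta> *\<^sub>R y" for y
      by (rule eigenvectors_orthogonal[OF T(2) Tv that \<open>\<alpha> \<noteq> \<beta>\<close>])
    show ?thesis
      using v(2,3) vf vy Tv \<open>\<epsilon> > 0\<close> by (intro exI[of _ v]) simp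
  qed
  moreover have "\<forall>k\<in>Z. T (f k) = \<alpha> *\<^sub>R f k"
    using g(1) by (simp add: f_def eigenspace_of_real)
  moreover have "\<forall>i\<in>Z. \<forall>j\<in>Z. cinner (f i) (f j) = (if i = j then 1 else 0)"
    by (simp add: f_def g(2))
  ultimately show ?thesis
    by blast
qed

section \<open>Realising an admissible sequence\<close>

lemma exists_diagonal_basis:
  fixes T :: "'a::complex_hilbert \<Rightarrow> 'a" and d :: "nat \<Rightarrow> real"
  assumes sep: "separable_space (euclidean :: 'a topology)"
    and T: "bounded_op T" "selfadjoint T"
    and range: "\<And>x. a * (norm x)\<^sup>2 \<le> inner (T x) x" "\<And>x. inner (T x) x \<le> b * (norm x)\<^sup>2"
    and w: "weyl_point T a" "weyl_point T b"
    and d: "\<And>k. a \<le> d k \<and> d k \<le> b"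
    and div: "\<not> summable (\<lambda>k. min (d k - a) (b - d k))"
    and za: "ecard {k. d k = a} \<le> ecdim (eigenspace T (complex_of_real a))"
    and zb: "ecard {k. d k = b} \<le> ecdim (eigenspace T (complex_of_real b))"
  shows "\<exists>e. orthonormal_basis e \<and> (\<forall>k. inner (T (e k)) (e k) = d k)"
proof -
  have "a < b"
  proof (rule ccontr)
    assume "\<not> a < b"
    then have "min (d k - a) (b - d k) = 0" for k
      using d[of k] by linarith
    then show False
      using div by simp
  qed
  then have "a \<noteq> b" "b \<noteq> a"
    by auto
  obtain fa where fa: "\<forall>k\<in>{k. d k = a}. T (fa k) = a *\<^sub>R fa k"
    "\<forall>i\<in>{k. d k = a}. \<forall>j\<in>{k. d k = a}. cinner (fa i) (fa j) = (if i = j then 1 else 0)"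
    "\<forall>N \<epsilon>. finite N \<longrightarrow> \<epsilon> > 0 \<longrightarrow> (\<exists>v. norm v = 1 \<and> (\<forall>g\<in>N. cinner v g = 0) \<and>
      (\<forall>k\<in>{k. d k = a}. cinner v (fa k) = 0) \<and> (\<forall>y. T y = b *\<^sub>R y \<longrightarrow> cinner v y = 0) \<and>
      norm (T v - a *\<^sub>R v) < \<epsilon>)"
    using eigenvector_family_with_weyl_vectors[OF T \<open>a \<noteq> b\<close> w(1) za] by blast
  obtain fb where fb: "\<forall>k\<in>{k. d k = b}. T (fb k) = b *\<^sub>R fb k"
    "\<forall>i\<in>{k. d k = b}. \<forall>j\<in>{k. d k = b}. cinner (fb i) (fb j) = (if i = j then 1 else 0)"
    "\<forall>N \<epsilon>. finite N \<longrightarrow> \<epsilon> > 0 \<longrightarrow> (\<exists>v. norm v = 1 \<and> (\<forall>g\<in>N. cinner v g = 0) \<and>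
      (\<forall>k\<in>{k. d k = b}. cinner v (fb k) = 0) \<and> (\<forall>y. T y = a *\<^sub>R y \<longrightarrow> cinner v y = 0) \<and>
      norm (T v - b *\<^sub>R v) < \<epsilon>)"
    using eigenvector_family_with_weyl_vectors[OF T \<open>b \<noteq> a\<close> w(2) zb] by blast
  define f where "f k = (if d k = a then fa k else fb k)" for k
  define I where "I = {k. a < d k \<and> d k < b}"
  have I: "d k = a \<or> d k = b" if "k \<notin> I" for k
    using that d[of k] by (auto simp: I_def)
  have Tf: "T (f k) = d k *\<^sub>R f k" if "k \<notin> I" for k
    using I[OF that] fa(1) fb(1) by (auto simp: f_def)
  have f_orth: "cinner (f i) (f j) = (if i = j then 1 else 0)" if "i \<notin> I" "j \<notin> I" for i j
  proof (cases "d i = d j")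
    case True
    then show ?thesis
      using I[OF that(2)] fa(2) fb(2) \<open>a \<noteq> b\<close> by (auto simp: f_def)
  next
    case False
    then show ?thesis
      using eigenvectors_orthogonal[OF T(2) Tf[OF that(1)] Tf[OF that(2)]] by auto
  qed
  have value_near: "\<bar>inner (T v) v - c\<bar> < \<epsilon>" if "norm v = 1" "norm (T v - c *\<^sub>R v) < \<epsilon>" for v c \<epsilon>
  proof -
    have "inner (T v) v - c = inner (T v - c *\<^sub>R v) v"
      using that(1) by (simp add: inner_diff_left norm_eq_1)
    then show ?thesis
      using Cauchy_Schwarz_ineq2[of "T v - c *\<^sub>R v" v] that by simp
  qed
  \<comment> \<open>An interior value is reached by mixing approximate eigenvectors \<open>u\<close>
    for \<open>a\<close> and \<open>z\<close> for \<open>b\<close>. The tolerances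
    \<open>s - a\<close> and \<open>b - s\<close> place their values on opposite sides of
    \<open>s\<close>.\<close>
  have attains: "\<exists>v. norm v = 1 \<and> (\<forall>g\<in>N \<union> f ` (- I). cinner v g = 0) \<and> inner (T v) v = s"
    if N: "finite N" and s: "a < s" "s < b" for N s
  proof -
    obtain u where u: "norm u = 1" "\<forall>g\<in>N. cinner u g = 0" "\<forall>k\<in>{k. d k = a}. cinner u (fa k) = 0"
      "\<forall>y. T y = b *\<^sub>R y \<longrightarrow> cinner u y = 0" "norm (T u - a *\<^sub>R u) < s - a"
      using fa(3)[rule_format, OF N, of "s - a"] s by auto
    have "finite (N \<union> {u, T u})"
      using N by simp
    then obtain z where z: "norm z = 1" "\<forall>g\<in>N \<union> {u, T u}. cinner z g = 0"
      "\<forall>k\<in>{k. d k = b}. cinner z (fb k) = 0"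
      "\<forall>y. T y = a *\<^sub>R y \<longrightarrow> cinner z y = 0" "norm (T z - b *\<^sub>R z) < b - s"
      using fb(3)[rule_format, of "N \<union> {u, T u}" "b - s"] s by auto
    \<comment> \<open>\<open>u\<close> avoids the selected eigenvectors for \<open>a\<close> and all
      eigenvectors for \<open>b\<close>, hence the whole of \<open>f\<close> outside
      \<open>I\<close>, even if infinite; symmetrically for \<open>z\<close>.\<close>
    have uf: "cinner u (f k) = 0" and zf: "cinner z (f k) = 0" if "k \<notin> I" for k
      using I[OF that] u(3,4) z(3,4) fa(1) fb(1) \<open>a \<noteq> b\<close> by (auto simp: f_def)
    have qu: "inner (T u) u < s" and qz: "s < inner (T z) z"
      using value_near[OF u(1,5)] value_near[OF z(1,5)] by linarith+
    define l where "l = (inner (T z) z - s) / (inner (T z) z - inner (T u) u)"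
    have l: "0 \<le> l" "l \<le> 1"
      using qu qz by (simp_all add: l_def)
    have "l * (inner (T z) z - inner (T u) u) = inner (T z) z - s"
      using qu qz by (simp add: l_def)
    then have ls: "l * inner (T u) u + (1 - l) * inner (T z) z = s"
      by (simp add: algebra_simps)
    have zu: "cinner z u = 0" "cinner z (T u) = 0"
      using z(2) by auto
    define v where "v = sqrt l *\<^sub>R u + sqrt (1 - l) *\<^sub>R z"
    have "norm v = 1" "inner (T v) v = s"
      unfolding v_def using combine_orthogonal[OF T u(1) z(1) zu l] ls by auto
    moreover have "cinner v g = 0" if "g \<in> N \<union> f ` (- I)" for g
      using that u(2) z(2) uf zf by (auto simp: v_def cinner_add_left cinner_scaleR_left)
    ultimately show ?thesis
      by blast
  qed
  have range1: "a \<le> inner (T x) x \<and> inner (T x) x \<le> b" if "norm x = 1" for x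
    using range[of x] that by simp
  \<comment> \<open>Entries at the endpoints contribute zero, so dropping them keeps the
    series.\<close>
  have "(\<lambda>k. if k \<in> I then min (d k - a) (b - d k) else 0) = (\<lambda>k. min (d k - a) (b - d k))"
  proof
    fix k
    show "(if k \<in> I then min (d k - a) (b - d k) else 0) = min (d k - a) (b - d k)"
      using I[of k] d[of k] by auto
  qed
  then have div': "\<not> summable (\<lambda>k. if k \<in> I then min (d k - a) (b - d k) else 0)"
    using div by simp
  have dI: "a < d k \<and> d k < b" if "k \<in> I" for k
    using that by (simp add: I_def)
  obtain e where e: "orthonormal_basis e" "\<forall>k\<in>I. inner (T (e k)) (e k) = d k"
    "\<forall>k. k \<notin> I \<longrightarrow> e k = f k"
    using orthonormal_basis_with_diagonal[OF sep T range1 f_orth attains dI div'] by blast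
  have "inner (T (e k)) (e k) = d k" for k
  proof (cases "k \<in> I")
    case False
    then have "e k = f k"
      using e(3) by simp
    moreover have "inner (f k) (f k) = 1"
      using orthonormal_basis_norm[OF e(1), of k] \<open>e k = f k\<close> by (simp add: norm_eq_1)
    ultimately show ?thesis
      using Tf[OF False] by simp
  qed (use e(2) in simp)
  with e(1) show ?thesis
    by blast
qed

section \<open>Proof of the characterisation\<close>

text \<open>Whether \<open>W\<close> contains the endpoints does not affect the distance; hence the
  competitors \<open>a - \<epsilon>\<close> and \<open>b + \<epsilon>\<close> just outside.\<close>

lemma infdist_complement_interval:
  fixes W :: "complex set"
  assumes W: "complex_of_real ` {a<..<b} \<subseteq> W" "W \<subseteq> complex_of_real ` {a..b}"
    and t: "a \<le> t" "t \<le> b"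
  shows "infdist (complex_of_real t) (\<real> - W) = min (t - a) (b - t)"
proof (rule antisym)
  have mem: "complex_of_real u \<in> \<real> - W" if "u < a \<or> b < u" for u
    using W(2) that by auto
  show "infdist (complex_of_real t) (\<real> - W) \<le> min (t - a) (b - t)"
  proof (rule field_le_epsilon)
    fix \<epsilon> :: real assume "\<epsilon> > 0"
    have "infdist (complex_of_real t) (\<real> - W) \<le> dist (complex_of_real t) (complex_of_real (a - \<epsilon>))"
      using \<open>\<epsilon> > 0\<close> by (intro infdist_le mem) simp
    moreover have "infdist (complex_of_real t) (\<real> - W) \<le> dist (complex_of_real t) (complex_of_real (b + \<epsilon>))"
      using \<open>\<epsilon> > 0\<close> by (intro infdist_le mem) simp
    ultimately show "infdist (complex_of_real t) (\<real> - W) \<le> min (t - a) (b - t) + \<epsilon>"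
      using t \<open>\<epsilon> > 0\<close> unfolding dist_of_real dist_real_def by linarith
  qed
  have ne: "\<real> - W \<noteq> {}"
    using mem[of "a - 1"] by (simp only: less_add_one diff_less_eq) blast
  have "min (t - a) (b - t) \<le> dist (complex_of_real t) z" if z: "z \<in> \<real> - W" for z
  proof -
    obtain u where u: "z = complex_of_real u"
      using z by (auto elim: Reals_cases)
    have "u \<notin> {a<..<b}"
    proof
      assume "u \<in> {a<..<b}"
      then have "z \<in> W"
        unfolding u by (intro subsetD[OF W(1)] imageI)
      with z show False
        by simp
    qed
    then show ?thesis
      using t unfolding u dist_of_real dist_real_def by auto
  qed
  then show "min (t - a) (b - t) \<le> infdist (complex_of_real t) (\<real> - W)"
    unfolding infdist_notempty[OF ne] by (rule cINF_greatest[OF ne])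
qed

theorem theorem4p6:
  fixes T :: "'a::complex_hilbert \<Rightarrow> 'a" and d :: "nat \<Rightarrow> complex"
  assumes separable: "separable_space (euclidean :: 'a topology)"
    and infinite_dim: "ecdim (UNIV :: 'a set) = \<infinity>"
    and bounded: "bounded_op T"
    and selfadj: "selfadjoint T"
    and range: "numerical_range T \<subseteq> ess_numerical_range T"
    and three_points: "3 \<le> ecard (ess_spectrum T)"
  shows "d \<in> diagonals T \<longleftrightarrow>
    (\<forall>k. d k \<in> numerical_range T) \<and>
    (\<Sum>k. ennreal (infdist (d k) (\<real> - ess_numerical_range T))) = \<infinity> \<and>
    ecard {k. d k = complex_of_real (min_ess_spectrum T)}
      \<le> ecdim (eigenspace T (complex_of_real (min_ess_spectrum T))) \<and>
    ecard {k. d k = complex_of_real (max_ess_spectrum T)}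
      \<le> ecdim (eigenspace T (complex_of_real (max_ess_spectrum T)))"
proof -
  note T = bounded selfadj
  define Q where "Q = (\<lambda>x. inner (T x) x) ` {x. norm x = 1}"
  define a where "a = Inf Q"
  define b where "b = Sup Q"
  have num_range: "numerical_range T = complex_of_real ` Q"
    by (auto simp: numerical_range_def Q_def selfadjoint_cinner_real[OF selfadj])
  have "\<exists>x :: 'a. x \<noteq> 0"
  proof (rule ccontr)
    assume "\<nexists>x :: 'a. x \<noteq> 0"
    then have "(UNIV :: 'a set) \<subseteq> cspan {0}"
      using complex_vector.span_zero by fastforce
    then have "\<exists>B. finite B \<and> (UNIV :: 'a set) \<subseteq> cspan B"
      by blast
    then show False
      using infinite_dim by (simp add: ecdim_def split: if_splits)
  qed
  then obtain x0 :: 'a where "x0 \<noteq> 0"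
    by blast
  then have "norm ((1 / norm x0) *\<^sub>R x0) = 1"
    by simp
  then have Q_ne: "Q \<noteq> {}"
    unfolding Q_def by blast
  obtain B where B: "\<And>x. norm (T x) \<le> norm x * B"
    using bounded bounded_linear.pos_bounded unfolding bounded_op_def by blast
  have abs_le: "\<bar>q\<bar> \<le> B" if q: "q \<in> Q" for q
  proof -
    obtain x where x: "norm x = 1" "q = inner (T x) x"
      using q by (auto simp: Q_def)
    show ?thesis
      using Cauchy_Schwarz_ineq2[of "T x" x] B[of x] x by simp
  qed
  have "- B \<le> q" "q \<le> B" if "q \<in> Q" for q
    using abs_le[OF that] by linarith+
  then have bdd: "bdd_below Q" "bdd_above Q"
    unfolding bdd_below_def bdd_above_def by blast+
  have Q_bounds: "a \<le> q" "q \<le> b" if "q \<in> Q" for q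
    using that bdd by (auto simp: a_def b_def intro: cInf_lower cSup_upper)
  have scaled: "\<exists>q\<in>Q. inner (T x) x = q * (norm x)\<^sup>2" if "x \<noteq> 0" for x
  proof
    define u where "u = (1 / norm x) *\<^sub>R x"
    have "norm u = 1" "x = norm x *\<^sub>R u"
      using that by (simp_all add: u_def)
    then show "inner (T u) u \<in> Q"
      by (simp add: Q_def)
    have "inner (T (norm x *\<^sub>R u)) (norm x *\<^sub>R u) = inner (T u) u * (norm x)\<^sup>2"
      by (simp add: bounded_opD[OF bounded] power2_eq_square)
    then show "inner (T x) x = inner (T u) u * (norm x)\<^sup>2"
      using \<open>x = norm x *\<^sub>R u\<close> by simp
  qed
  have T_range: "a * (norm x)\<^sup>2 \<le> inner (T x) x" "inner (T x) x \<le> b * (norm x)\<^sup>2" for x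
  proof -
    have "a * (norm x)\<^sup>2 \<le> inner (T x) x \<and> inner (T x) x \<le> b * (norm x)\<^sup>2"
    proof (cases "x = 0")
      case False
      then obtain q where q: "q \<in> Q" "inner (T x) x = q * (norm x)\<^sup>2"
        using scaled by blast
      show ?thesis
        unfolding q(2) using Q_bounds[OF q(1)] by (simp add: mult_right_mono)
    qed (simp add: bounded_opD[OF bounded])
    then show "a * (norm x)\<^sup>2 \<le> inner (T x) x" "inner (T x) x \<le> b * (norm x)\<^sup>2"
      by auto
  qed
  \<comment> \<open>Here \<open>W(T) \<subseteq> W\<^sub>e(T)\<close> enters: each value
    \<open>q\<close> is a limit along a subsequence of a diagonal, and a tail of that subsequence is
    an orthonormal sequence with values close to \<open>q\<close>.\<close>
  have sequence: "\<exists>x :: nat \<Rightarrow> 'a. (\<forall>i j. cinner (x i) (x j) = (if i = j then 1 else 0)) \<and>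
      (\<forall>i. \<bar>inner (T (x i)) (x i) - q\<bar> < \<epsilon>)" if "q \<in> Q" "\<epsilon> > 0" for q \<epsilon>
  proof -
    have "complex_of_real q \<in> ess_numerical_range T"
      using range \<open>q \<in> Q\<close> unfolding num_range by blast
    then obtain e r where e: "orthonormal_basis e" and r: "strict_mono r"
      and lim: "(\<lambda>n. cinner (T (e (r n))) (e (r n))) \<longlonglongrightarrow> complex_of_real q"
      by (auto simp: ess_numerical_range_def diagonals_def comp_def)
    have "(\<lambda>n. inner (T (e (r n))) (e (r n))) \<longlonglongrightarrow> q"
      using tendsto_Re[OF lim] by (simp add: Re_cinner)
    from LIMSEQ_D[OF this \<open>\<epsilon> > 0\<close>] obtain n where
      n: "\<And>m. m \<ge> n \<Longrightarrow> \<bar>inner (T (e (r m))) (e (r m)) - q\<bar> < \<epsilon>"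
      by auto
    have "r (n + i) = r (n + j) \<longleftrightarrow> i = j" for i j
      using strict_mono_eq[OF r] by simp
    then show ?thesis
      using e n by (intro exI[of _ "\<lambda>i. e (r (n + i))"]) (simp add: orthonormal_basis_def)
  qed
  have weyl_a: "weyl_point T a"
  proof (rule weyl_point_lower_bound[OF T T_range])
    fix \<epsilon> :: real assume "\<epsilon> > 0"
    then obtain q where q: "q \<in> Q" "q < a + \<epsilon>"
      using cInf_lessD[OF Q_ne, of "a + \<epsilon>"] by (auto simp: a_def)
    then obtain x :: "nat \<Rightarrow> 'a" where x: "\<forall>i j. cinner (x i) (x j) = (if i = j then 1 else 0)"
      "\<forall>i. \<bar>inner (T (x i)) (x i) - q\<bar> < a + \<epsilon> - q"
      using sequence[OF q(1), of "a + \<epsilon> - q"] by auto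
    have "inner (T (x i)) (x i) < a + \<epsilon>" for i
      using spec[OF x(2), of i] by linarith
    with x(1) show "\<exists>x :: nat \<Rightarrow> 'a. (\<forall>i j. cinner (x i) (x j) = (if i = j then 1 else 0)) \<and>
        (\<forall>i. inner (T (x i)) (x i) < a + \<epsilon>)"
      by blast
  qed
  \<comment> \<open>The upper endpoint of \<open>T\<close> is the lower endpoint of
    \<open>-T\<close>.\<close>
  have "weyl_point (\<lambda>x. - T x) (- b)"
  proof (rule weyl_point_lower_bound[OF bounded_op_uminus[OF bounded] selfadjoint_uminus[OF selfadj]])
    show "- b * (norm x)\<^sup>2 \<le> inner (- T x) x" "inner (- T x) x \<le> - a * (norm x)\<^sup>2" for x
      using T_range[of x] by simp_all
    fix \<epsilon> :: real assume "\<epsilon> > 0"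
    then obtain q where q: "q \<in> Q" "b - \<epsilon> < q"
      using less_cSupD[OF Q_ne, of "b - \<epsilon>"] by (auto simp: b_def)
    then obtain x :: "nat \<Rightarrow> 'a" where x: "\<forall>i j. cinner (x i) (x j) = (if i = j then 1 else 0)"
      "\<forall>i. \<bar>inner (T (x i)) (x i) - q\<bar> < q - (b - \<epsilon>)"
      using sequence[OF q(1), of "q - (b - \<epsilon>)"] by auto
    have "inner (- T (x i)) (x i) < - b + \<epsilon>" for i
      using spec[OF x(2), of i] unfolding inner_minus_left by linarith
    with x(1) show "\<exists>x :: nat \<Rightarrow> 'a. (\<forall>i j. cinner (x i) (x j) = (if i = j then 1 else 0)) \<and>
        (\<forall>i. inner (- T (x i)) (x i) < - b + \<epsilon>)"
      by blast
  qed
  then have weyl_b: "weyl_point T b"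
    by (simp only: weyl_point_uminus)
  have min_eq: "min_ess_spectrum T = a"
    unfolding min_ess_spectrum_def
  proof (rule Least_equality)
    show "complex_of_real a \<in> ess_spectrum T"
      by (rule weyl_point_ess_spectrum[OF bounded weyl_a])
    show "a \<le> c" if "complex_of_real c \<in> ess_spectrum T" for c
      by (rule real_ess_spectrum_bounds(1)[OF bounded T_range that])
  qed
  have max_eq: "max_ess_spectrum T = b"
    unfolding max_ess_spectrum_def
  proof (rule Greatest_equality)
    show "complex_of_real b \<in> ess_spectrum T"
      by (rule weyl_point_ess_spectrum[OF bounded weyl_b])
    show "c \<le> b" if "complex_of_real c \<in> ess_spectrum T" for c
      by (rule real_ess_spectrum_bounds(2)[OF bounded T_range that])
  qed
  \<comment> \<open>The constant sequence \<open>s\<close> has divergent series and no entry at an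
    endpoint, so it is itself a diagonal, and \<open>s\<close> is its limit.\<close>
  have inside: "complex_of_real s \<in> ess_numerical_range T" if "a < s" "s < b" for s
  proof -
    have "min (s - a) (b - s) \<noteq> 0"
      using that by simp
    then have "\<not> summable (\<lambda>k :: nat. min (s - a) (b - s))"
      by (simp only: summable_const_iff not_False_eq_True)
    moreover have "ecard {k :: nat. s = a} \<le> ecdim (eigenspace T (complex_of_real a))"
      "ecard {k :: nat. s = b} \<le> ecdim (eigenspace T (complex_of_real b))"
      using that by (simp_all add: ecard_def flip: zero_enat_def)
    moreover have "a \<le> s \<and> s \<le> b"
      using that by simp
    ultimately obtain e where e: "orthonormal_basis e" "\<forall>k. inner (T (e k)) (e k) = s"
      using exists_diagonal_basis[OF separable T T_range weyl_a weyl_b, of "\<lambda>_. s"] by blast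
    have "(\<lambda>n. complex_of_real s) = (\<lambda>n. cinner (T (e n)) (e n))"
      using e(2) by (simp add: selfadjoint_cinner_real[OF selfadj])
    with e(1) have "(\<lambda>n. complex_of_real s) \<in> diagonals T"
      unfolding diagonals_def by blast
    then show ?thesis
      unfolding ess_numerical_range_def
      by (intro CollectI bexI[of _ "\<lambda>n. complex_of_real s"] exI[of _ id])
        (simp_all add: strict_mono_id comp_def)
  qed
  have W_sub: "ess_numerical_range T \<subseteq> complex_of_real ` {a..b}"
  proof
    fix z assume "z \<in> ess_numerical_range T"
    then obtain e r where e: "orthonormal_basis e"
      and lim: "(\<lambda>n. cinner (T (e (r n))) (e (r n))) \<longlonglongrightarrow> z"
      by (auto simp: ess_numerical_range_def diagonals_def comp_def)
    have "inner (T (e k)) (e k) \<in> Q" for k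
      by (simp add: Q_def orthonormal_basis_norm[OF e])
    then have "cinner (T (e k)) (e k) \<in> complex_of_real ` {a..b}" for k
      using Q_bounds unfolding selfadjoint_cinner_real[OF selfadj] by auto
    moreover have "closed (complex_of_real ` {a..b})"
      by (intro compact_imp_closed compact_continuous_image continuous_intros compact_Icc)
    ultimately show "z \<in> complex_of_real ` {a..b}"
      by (intro closed_sequentially[OF _ _ lim])
  qed
  have W_sup: "complex_of_real ` {a<..<b} \<subseteq> ess_numerical_range T"
    using inside by auto
  note dist_eq = infdist_complement_interval[OF W_sup W_sub]
  show ?thesis
    unfolding min_eq max_eq
  proof (intro iffI conjI)
    assume "d \<in> diagonals T"
    then obtain e where e: "orthonormal_basis e" and d: "\<And>n. d n = complex_of_real (inner (T (e n)) (e n))"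
      by (auto simp: diagonals_def selfadjoint_cinner_real[OF selfadj])
    have e_orth: "cinner (e i) (e j) = (if i = j then 1 else 0)" for i j
      using e by (simp add: orthonormal_basis_def)
    have Q: "inner (T (e k)) (e k) \<in> Q" for k
      by (simp add: Q_def orthonormal_basis_norm[OF e])
    then show "\<forall>k. d k \<in> numerical_range T"
      by (simp add: num_range d)
    show "(\<Sum>k. ennreal (infdist (d k) (\<real> - ess_numerical_range T))) = \<infinity>"
    \<comment> \<open>A finite sum would confine the essential spectrum to the two endpoints,
      against the three points assumed.\<close>
    proof (rule ccontr)
      define w where "w k = min (inner (T (e k)) (e k) - a) (b - inner (T (e k)) (e k))" for k
      assume "(\<Sum>k. ennreal (infdist (d k) (\<real> - ess_numerical_range T))) \<noteq> \<infinity>"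
      then have "(\<Sum>k. ennreal (w k)) \<noteq> \<infinity>"
        by (simp add: d w_def dist_eq Q_bounds[OF Q])
      moreover have "0 \<le> w k" for k
        using Q_bounds[OF Q, of k] by (simp add: w_def)
      ultimately have "summable w"
        by (intro summable_suminf_not_top) simp_all
      then have sub: "ess_spectrum T \<subseteq> {complex_of_real a, complex_of_real b}"
        unfolding w_def by (rule ess_spectrum_subset_if_summable[OF T T_range e])
      have "card (ess_spectrum T) \<le> card {complex_of_real a, complex_of_real b}"
        by (rule card_mono[OF _ sub]) simp
      also have "\<dots> \<le> 2"
        by (simp add: card_insert_if)
      finally have "card (ess_spectrum T) \<le> 2" .
      moreover have "finite (ess_spectrum T)"
        by (rule finite_subset[OF sub]) simp
      then have "3 \<le> enat (card (ess_spectrum T))"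
        using three_points by (simp add: ecard_def)
      then have "3 \<le> card (ess_spectrum T)"
        by (simp add: numeral_eq_enat)
      ultimately show False
        by simp
    qed
    define M where "M = \<bar>b - a\<bar> + 1"
    have M: "M > 0" "b - a \<le> M"
      by (auto simp: M_def)
    \<comment> \<open>At an extreme value the norm bound degenerates to zero, so the basis vector is
      an eigenvector.\<close>
    have "e ` {k. d k = complex_of_real a} \<subseteq> eigenspace T (complex_of_real a)"
    proof safe
      fix k assume "d k = complex_of_real a"
      then have "(norm (T (e k) - a *\<^sub>R e k))\<^sup>2 \<le> 0"
        using shift_norm_le(1)[OF T T_range M, of "e k"] by (simp add: d orthonormal_basis_norm[OF e])
      then show "e k \<in> eigenspace T (complex_of_real a)"
        by (simp add: eigenspace_of_real)
    qed
    then show "ecard {k. d k = complex_of_real a} \<le> ecdim (eigenspace T (complex_of_real a))"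
      by (rule orthonormal_card_le_dim[OF e_orth])
    have "e ` {k. d k = complex_of_real b} \<subseteq> eigenspace T (complex_of_real b)"
    proof safe
      fix k assume "d k = complex_of_real b"
      then have "(norm (T (e k) - b *\<^sub>R e k))\<^sup>2 \<le> 0"
        using shift_norm_le(2)[OF T T_range M, of "e k"] by (simp add: d orthonormal_basis_norm[OF e])
      then show "e k \<in> eigenspace T (complex_of_real b)"
        by (simp add: eigenspace_of_real)
    qed
    then show "ecard {k. d k = complex_of_real b} \<le> ecdim (eigenspace T (complex_of_real b))"
      by (rule orthonormal_card_le_dim[OF e_orth])
  next
    assume *: "(\<forall>k. d k \<in> numerical_range T) \<and>
      (\<Sum>k. ennreal (infdist (d k) (\<real> - ess_numerical_range T))) = \<infinity> \<and>
      ecard {k. d k = complex_of_real a} \<le> ecdim (eigenspace T (complex_of_real a)) \<and>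
      ecard {k. d k = complex_of_real b} \<le> ecdim (eigenspace T (complex_of_real b))"
    then have "\<forall>k. \<exists>q\<in>Q. d k = complex_of_real q"
      unfolding num_range by blast
    then obtain c where c: "\<And>k. c k \<in> Q" "\<And>k. d k = complex_of_real (c k)"
      by metis
    have bounds: "a \<le> c k \<and> c k \<le> b" for k
      using Q_bounds[OF c(1)] by simp
    have "(\<Sum>k. ennreal (min (c k - a) (b - c k))) = \<infinity>"
      using * bounds by (simp add: c(2) dist_eq)
    moreover have "0 \<le> min (c k - a) (b - c k)" for k
      using bounds[of k] by simp
    ultimately have div: "\<not> summable (\<lambda>k. min (c k - a) (b - c k))"
      using suminf_ennreal2[of "\<lambda>k. min (c k - a) (b - c k)"] by auto
    have "ecard {k. c k = a} \<le> ecdim (eigenspace T (complex_of_real a))"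
      "ecard {k. c k = b} \<le> ecdim (eigenspace T (complex_of_real b))"
      using * by (simp_all add: c(2))
    from exists_diagonal_basis[OF separable T T_range weyl_a weyl_b bounds div this]
    obtain e where e: "orthonormal_basis e" "\<forall>k. inner (T (e k)) (e k) = c k"
      by blast
    have "d = (\<lambda>n. cinner (T (e n)) (e n))"
      using e(2) by (simp add: fun_eq_iff c(2) selfadjoint_cinner_real[OF selfadj])
    with e(1) show "d \<in> diagonals T"
      unfolding diagonals_def by blast
  qed
qed

end
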